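(* If $R$ is a unital archimedean $\ell u$-ring and $G$ is an archimedean $\ell u$-group, then $R\otimes_a G$ is an $\ell u$-module over $R$.
   Context: An $\ell u$-group is an abelian lattice-ordered group with a strong unit. An $\ell u$-ring is a lattice-ordered ring whose additive $\ell$-group has a strong unit; unital means it has a multiplicative unit, which is required to coincide with the strong unit. An $\ell u$-module over $R$ is a lattice-ordered $R$-module (positive scalars act by $\ell$-group endomorphisms and $R^+M^+\subseteq M^+$) with a strong unit. Archimedean: $nx\le y$ for all $n\in\mathbb N$ implies $x\le 0$. For archimedean $\ell$-groups $G,H$, $G\otimes_a H$ denotes the archimedean tensor product (Fremlin; Buskes–van Rooij): the archimedean $\ell$-group with an $\ell$-bilinear map $G\times H\to G\otimes_a H$ (an $\ell$-group homomorphism in each argument when the other is positive) universal among $\ell$-bilinear maps into archimedean $\ell$-groups; here $R\otimes_a G$ refers to the additive $\ell$-group of $R$. *)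

theory Defs
  imports "HOL-Algebra.Algebra"
begin

(* As in HOL-Algebra, an additive abelian group is a ring record whose multiplicative fields are
   ignored. So a lattice-ordered ring R is also literally the record of its additive l-group. *)
record 'a lring = "'a ring" +
  leq :: "'a \<Rightarrow> 'a \<Rightarrow> bool" (infixl \<open>\<preceq>\<index>\<close> 50)

definition order_of :: "('a, 'm) lring_scheme \<Rightarrow> 'a gorder" where
  "order_of G = \<lparr>carrier = carrier G, eq = (=), le = leq G\<rparr>"

locale l_group = abelian_group G + ord: lattice "order_of G"
  for G :: "('a, 'm) lring_scheme" (structure) +
  assumes add_mono:
    "\<lbrakk>x \<in> carrier G; y \<in> carrier G; z \<in> carrier G; x \<preceq> y\<rbrakk> \<Longrightarrow> x \<oplus> z \<preceq> y \<oplus> z"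

definition strong_unit :: "('a, 'm) lring_scheme \<Rightarrow> 'a \<Rightarrow> bool" where
  "strong_unit G u \<longleftrightarrow> u \<in> carrier G \<and> \<zero>\<^bsub>G\<^esub> \<preceq>\<^bsub>G\<^esub> u \<and>
     (\<forall>x \<in> carrier G. \<exists>n::nat. x \<preceq>\<^bsub>G\<^esub> [n] \<cdot>\<^bsub>G\<^esub> u)"

definition archimedean :: "('a, 'm) lring_scheme \<Rightarrow> bool" where
  "archimedean G \<longleftrightarrow>
     (\<forall>x \<in> carrier G. \<forall>y \<in> carrier G. (\<forall>n::nat. [n] \<cdot>\<^bsub>G\<^esub> x \<preceq>\<^bsub>G\<^esub> y) \<longrightarrow> x \<preceq>\<^bsub>G\<^esub> \<zero>\<^bsub>G\<^esub>)"

locale lu_group = l_group +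
  assumes ex_strong_unit: "\<exists>u. strong_unit G u"

(* ring in HOL-Algebra is unital and associative, but not assumed commutative. *)
locale unital_l_ring = ring R + l_group R
  for R :: "('a, 'm) lring_scheme" (structure) +
  assumes mult_pos:
    "\<lbrakk>x \<in> carrier R; y \<in> carrier R; \<zero> \<preceq> x; \<zero> \<preceq> y\<rbrakk> \<Longrightarrow> \<zero> \<preceq> x \<otimes> y"

locale unital_lu_ring = unital_l_ring +
  assumes strong_unit_one: "strong_unit R \<one>"

definition l_hom ::
    "('a, 'm) lring_scheme \<Rightarrow> ('b, 'n) lring_scheme \<Rightarrow> ('a \<Rightarrow> 'b) set" where
  "l_hom G H = {f \<in> hom (add_monoid G) (add_monoid H).
     \<forall>x \<in> carrier G. \<forall>y \<in> carrier G.
       f (x \<squnion>\<^bsub>order_of G\<^esub> y) = f x \<squnion>\<^bsub>order_of H\<^esub> f y \<and>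
       f (x \<sqinter>\<^bsub>order_of G\<^esub> y) = f x \<sqinter>\<^bsub>order_of H\<^esub> f y}"

definition l_bilinear ::
    "('a, 'm) lring_scheme \<Rightarrow> ('b, 'n) lring_scheme \<Rightarrow> ('c, 'k) lring_scheme
      \<Rightarrow> ('a \<Rightarrow> 'b \<Rightarrow> 'c) \<Rightarrow> bool" where
  "l_bilinear G H K b \<longleftrightarrow>
     (\<forall>x \<in> carrier G. b x \<in> hom (add_monoid H) (add_monoid K)) \<and>
     (\<forall>y \<in> carrier H. (\<lambda>x. b x y) \<in> hom (add_monoid G) (add_monoid K)) \<and>
     (\<forall>x \<in> carrier G. \<zero>\<^bsub>G\<^esub> \<preceq>\<^bsub>G\<^esub> x \<longrightarrow> b x \<in> l_hom H K) \<and>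
     (\<forall>y \<in> carrier H. \<zero>\<^bsub>H\<^esub> \<preceq>\<^bsub>H\<^esub> y \<longrightarrow> (\<lambda>x. b x y) \<in> l_hom G K)"

(* The universal property of t : G x H -> T, tested against the archimedean l-groups K whose
   carrier is a subset of the type 'k. *)
definition universal_l_bilinear ::
    "'k itself \<Rightarrow> ('a, 'm) lring_scheme \<Rightarrow> ('b, 'n) lring_scheme \<Rightarrow> ('c, 'l) lring_scheme
      \<Rightarrow> ('a \<Rightarrow> 'b \<Rightarrow> 'c) \<Rightarrow> bool" where
  "universal_l_bilinear (_ :: 'k itself) G H T t \<longleftrightarrow>
     (\<forall>(K :: 'k lring) b. l_group K \<and> archimedean K \<and> l_bilinear G H K b \<longrightarrow>
        (\<exists>f \<in> l_hom T K.
           (\<forall>x \<in> carrier G. \<forall>y \<in> carrier H. f (t x y) = b x y) \<and>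
           (\<forall>f' \<in> l_hom T K.
              (\<forall>x \<in> carrier G. \<forall>y \<in> carrier H. f' (t x y) = b x y) \<longrightarrow>
              (\<forall>z \<in> carrier T. f' z = f z))))"

(* (T, t) is the archimedean tensor product of G and H. HOL cannot quantify over types inside a
   formula, so the test objects live in the type ('a \<times> 'b) list + 'c. This loses nothing:
   T and its l-subgroup T0 generated by the elements t x y both have copies there, and comparing
   the identity of T with T \<rightarrow> T0 \<subseteq> T gives T = T0. Moreover, the l-subgroup of any K
   generated by the values of a bilinear map has at most as many elements as ('a \<times> 'b) list
   and so also has a copy there. Hence universality against arbitrary archimedean l-groups, in
   any type, follows. *)
definition archimedean_tensor ::
    "('a, 'm) lring_scheme \<Rightarrow> ('b, 'n) lring_scheme \<Rightarrow> ('c, 'l) lring_scheme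
      \<Rightarrow> ('a \<Rightarrow> 'b \<Rightarrow> 'c) \<Rightarrow> bool" where
  "archimedean_tensor G H (T :: ('c, 'l) lring_scheme) (t :: 'a \<Rightarrow> 'b \<Rightarrow> 'c) \<longleftrightarrow>
     l_group T \<and> archimedean T \<and> l_bilinear G H T t \<and>
     universal_l_bilinear TYPE(('a \<times> 'b) list + 'c) G H T t"

(* Not based on the library locale module, which requires a commutative scalar ring. *)
locale l_module = R: unital_l_ring R + M: l_group M
  for R :: "('r, 'm) lring_scheme" and M :: "('a, 'n) lring_scheme"
    and scale :: "'r \<Rightarrow> 'a \<Rightarrow> 'a" +
  assumes scale_closed: "\<lbrakk>r \<in> carrier R; x \<in> carrier M\<rbrakk> \<Longrightarrow> scale r x \<in> carrier M"
    and scale_l_distr: "\<lbrakk>r \<in> carrier R; s \<in> carrier R; x \<in> carrier M\<rbrakk>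
      \<Longrightarrow> scale (r \<oplus>\<^bsub>R\<^esub> s) x = scale r x \<oplus>\<^bsub>M\<^esub> scale s x"
    and scale_r_distr: "\<lbrakk>r \<in> carrier R; x \<in> carrier M; y \<in> carrier M\<rbrakk>
      \<Longrightarrow> scale r (x \<oplus>\<^bsub>M\<^esub> y) = scale r x \<oplus>\<^bsub>M\<^esub> scale r y"
    and scale_assoc: "\<lbrakk>r \<in> carrier R; s \<in> carrier R; x \<in> carrier M\<rbrakk>
      \<Longrightarrow> scale (r \<otimes>\<^bsub>R\<^esub> s) x = scale r (scale s x)"
    and scale_one: "x \<in> carrier M \<Longrightarrow> scale \<one>\<^bsub>R\<^esub> x = x"
    and scale_l_hom: "\<lbrakk>r \<in> carrier R; \<zero>\<^bsub>R\<^esub> \<preceq>\<^bsub>R\<^esub> r\<rbrakk> \<Longrightarrow> scale r \<in> l_hom M M"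
    and scale_pos: "\<lbrakk>r \<in> carrier R; x \<in> carrier M; \<zero>\<^bsub>R\<^esub> \<preceq>\<^bsub>R\<^esub> r; \<zero>\<^bsub>M\<^esub> \<preceq>\<^bsub>M\<^esub> x\<rbrakk>
      \<Longrightarrow> \<zero>\<^bsub>M\<^esub> \<preceq>\<^bsub>M\<^esub> scale r x"

locale lu_module = l_module +
  assumes ex_strong_unit: "\<exists>u. strong_unit M u"

end

theory Submission
  imports Defs
begin

text \<open>
  Multiplication by \<open>r \<ge> 0\<close> is an \<open>\<ell>\<close>-endomorphism of \<open>R\<close>, because \<open>1\<close> is a strong unit.
  So \<open>(s, g) \<mapsto> r s \<otimes> g\<close> is \<open>\<ell>\<close>-bilinear and induces an \<open>\<ell>\<close>-endomorphism \<open>act r\<close> of the tensor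
  product \<open>T\<close>. The difficulty is the additivity of \<open>act\<close> in \<open>r\<close>: the maps \<open>act (r + s)\<close> and
  \<open>act r + act s\<close> agree on tensors, but uniqueness applies only if the sum is an \<open>\<ell>\<close>-homomorphism.
  This follows once \<open>x \<bottom> y\<close> implies \<open>act r x \<bottom> y\<close>, which is where the archimedean property enters.
  Let \<open>e = 1 \<otimes> u\<close> with \<open>u\<close> a strong unit of \<open>G\<close>. On the part of the ``spectrum'' where \<open>N r\<close> is within
  \<open>1\<close> of a natural number \<open>k\<close>, the element \<open>N (act r x)\<close> is within \<open>c e\<close> of \<open>k x\<close>, where \<open>c\<close> depends
  only on \<open>x\<close>; this holds for tensors and passes to the \<open>\<ell>\<close>-subgroup that they generate, which is \<open>T\<close>.
  Since \<open>k x \<bottom> N y\<close>, it follows that \<open>N (act r x \<sqinter> y) \<le> c e\<close> there. As finitely many \<open>k\<close>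
  cover everything, this holds everywhere for all \<open>N\<close>, so \<open>act r x \<sqinter> y = 0\<close>.
\<close>

subsection \<open>Lattice-ordered groups\<close>

abbreviation ljoin :: "('a, 'm) lring_scheme \<Rightarrow> 'a \<Rightarrow> 'a \<Rightarrow> 'a" (infixl \<open>\<^bold>\<or>\<index>\<close> 55) where
  "ljoin G x y \<equiv> x \<squnion>\<^bsub>order_of G\<^esub> y"

abbreviation lmeet :: "('a, 'm) lring_scheme \<Rightarrow> 'a \<Rightarrow> 'a \<Rightarrow> 'a" (infixl \<open>\<^bold>\<and>\<index>\<close> 56) where
  "lmeet G x y \<equiv> x \<sqinter>\<^bsub>order_of G\<^esub> y"

definition pos_part :: "('a, 'm) lring_scheme \<Rightarrow> 'a \<Rightarrow> 'a" (\<open>pos\<index>\<close>) where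
  "pos_part G x = ljoin G x \<zero>\<^bsub>G\<^esub>"

text \<open>No absolute values occur: a zero meet already forces both elements to be nonnegative.
  Membership in the carrier is built in so that it travels along with the relation.\<close>

definition disj :: "('a, 'm) lring_scheme \<Rightarrow> 'a \<Rightarrow> 'a \<Rightarrow> bool" (infix \<open>\<bottom>\<index>\<close> 50) where
  "disj G x y \<longleftrightarrow> x \<in> carrier G \<and> y \<in> carrier G \<and> lmeet G x y = \<zero>\<^bsub>G\<^esub>"

lemma carrier_order_of [simp]: "carrier (order_of G) = carrier G"
  and le_order_of [simp]: "le (order_of G) = leq G"
  and eq_order_of [simp]: "eq (order_of G) = (=)"
  by (simp_all add: order_of_def)

text \<open>Replaces the \<open>least\<close> and \<open>greatest\<close> formulation of
  \<open>lattice\<close> by plain order conditions, in which the copy of an l-subgroup is easy to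
  check.\<close>

lemma l_groupI:
  assumes grp: "abelian_group G"
    and refl: "\<And>x. x \<in> carrier G \<Longrightarrow> x \<preceq>\<^bsub>G\<^esub> x"
    and antisym: "\<And>x y. \<lbrakk>x \<in> carrier G; y \<in> carrier G; x \<preceq>\<^bsub>G\<^esub> y; y \<preceq>\<^bsub>G\<^esub> x\<rbrakk> \<Longrightarrow> x = y"
    and trans: "\<And>x y z. \<lbrakk>x \<in> carrier G; y \<in> carrier G; z \<in> carrier G; x \<preceq>\<^bsub>G\<^esub> y; y \<preceq>\<^bsub>G\<^esub> z\<rbrakk> \<Longrightarrow> x \<preceq>\<^bsub>G\<^esub> z"
    and add: "\<And>x y z. \<lbrakk>x \<in> carrier G; y \<in> carrier G; z \<in> carrier G; x \<preceq>\<^bsub>G\<^esub> y\<rbrakk>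
       \<Longrightarrow> x \<oplus>\<^bsub>G\<^esub> z \<preceq>\<^bsub>G\<^esub> y \<oplus>\<^bsub>G\<^esub> z"
    and sup: "\<And>x y. \<lbrakk>x \<in> carrier G; y \<in> carrier G\<rbrakk> \<Longrightarrow> \<exists>s \<in> carrier G. x \<preceq>\<^bsub>G\<^esub> s \<and> y \<preceq>\<^bsub>G\<^esub> s \<and>
       (\<forall>z \<in> carrier G. x \<preceq>\<^bsub>G\<^esub> z \<longrightarrow> y \<preceq>\<^bsub>G\<^esub> z \<longrightarrow> s \<preceq>\<^bsub>G\<^esub> z)"
    and inf: "\<And>x y. \<lbrakk>x \<in> carrier G; y \<in> carrier G\<rbrakk> \<Longrightarrow> \<exists>s \<in> carrier G. s \<preceq>\<^bsub>G\<^esub> x \<and> s \<preceq>\<^bsub>G\<^esub> y \<and>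
       (\<forall>z \<in> carrier G. z \<preceq>\<^bsub>G\<^esub> x \<longrightarrow> z \<preceq>\<^bsub>G\<^esub> y \<longrightarrow> z \<preceq>\<^bsub>G\<^esub> s)"
  shows "l_group G"
proof -
  interpret partial_order "order_of G"
    by standard (simp_all add: refl antisym, blast intro: trans)
  have "lattice (order_of G)"
  proof
    fix x y assume xy: "x \<in> carrier (order_of G)" "y \<in> carrier (order_of G)"
    then obtain s where "s \<in> carrier G" "x \<preceq>\<^bsub>G\<^esub> s" "y \<preceq>\<^bsub>G\<^esub> s"
        "\<forall>z \<in> carrier G. x \<preceq>\<^bsub>G\<^esub> z \<longrightarrow> y \<preceq>\<^bsub>G\<^esub> z \<longrightarrow> s \<preceq>\<^bsub>G\<^esub> z"
      using sup[of x y] by auto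
    with xy have "least (order_of G) s (Upper (order_of G) {x, y})"
      by (auto simp: least_def Upper_def)
    then show "\<exists>s. least (order_of G) s (Upper (order_of G) {x, y})" ..
  next
    fix x y assume xy: "x \<in> carrier (order_of G)" "y \<in> carrier (order_of G)"
    then obtain s where "s \<in> carrier G" "s \<preceq>\<^bsub>G\<^esub> x" "s \<preceq>\<^bsub>G\<^esub> y"
        "\<forall>z \<in> carrier G. z \<preceq>\<^bsub>G\<^esub> x \<longrightarrow> z \<preceq>\<^bsub>G\<^esub> y \<longrightarrow> z \<preceq>\<^bsub>G\<^esub> s"
      using inf[of x y] by auto
    with xy have "greatest (order_of G) s (Lower (order_of G) {x, y})"
      by (auto simp: greatest_def Lower_def)
    then show "\<exists>s. greatest (order_of G) s (Lower (order_of G) {x, y})" ..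
  qed
  then show ?thesis
    by (intro l_group.intro grp l_group_axioms.intro add)
qed

context l_group
begin

section \<open>Order, joins and meets\<close>

lemma le_refl [simp]: "x \<in> carrier G \<Longrightarrow> x \<preceq> x"
  using ord.le_refl by simp

lemma le_trans: "\<lbrakk>x \<preceq> y; y \<preceq> z; x \<in> carrier G; y \<in> carrier G; z \<in> carrier G\<rbrakk> \<Longrightarrow> x \<preceq> z"
  using ord.le_trans[of x y z] by simp

lemma le_antisym: "\<lbrakk>x \<preceq> y; y \<preceq> x; x \<in> carrier G; y \<in> carrier G\<rbrakk> \<Longrightarrow> x = y"
  using ord.le_antisym[of x y] by simp

lemma join_closed [simp]: "\<lbrakk>x \<in> carrier G; y \<in> carrier G\<rbrakk> \<Longrightarrow> x \<^bold>\<or> y \<in> carrier G"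
  using ord.join_closed by simp

lemma meet_closed [simp]: "\<lbrakk>x \<in> carrier G; y \<in> carrier G\<rbrakk> \<Longrightarrow> x \<^bold>\<and> y \<in> carrier G"
  using ord.meet_closed by simp

lemma join_left [simp]: "\<lbrakk>x \<in> carrier G; y \<in> carrier G\<rbrakk> \<Longrightarrow> x \<preceq> x \<^bold>\<or> y"
  using ord.join_left by simp

lemma join_right [simp]: "\<lbrakk>x \<in> carrier G; y \<in> carrier G\<rbrakk> \<Longrightarrow> y \<preceq> x \<^bold>\<or> y"
  using ord.join_right by simp

lemma join_least: "\<lbrakk>x \<preceq> z; y \<preceq> z; x \<in> carrier G; y \<in> carrier G; z \<in> carrier G\<rbrakk> \<Longrightarrow> x \<^bold>\<or> y \<preceq> z"
  using ord.join_le[of x z y] by simp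

lemma meet_left [simp]: "\<lbrakk>x \<in> carrier G; y \<in> carrier G\<rbrakk> \<Longrightarrow> x \<^bold>\<and> y \<preceq> x"
  using ord.meet_left by simp

lemma meet_right [simp]: "\<lbrakk>x \<in> carrier G; y \<in> carrier G\<rbrakk> \<Longrightarrow> x \<^bold>\<and> y \<preceq> y"
  using ord.meet_right by simp

lemma meet_greatest: "\<lbrakk>z \<preceq> x; z \<preceq> y; x \<in> carrier G; y \<in> carrier G; z \<in> carrier G\<rbrakk> \<Longrightarrow> z \<preceq> x \<^bold>\<and> y"
  using ord.meet_le[of z x y] by simp

lemma join_unique:
  assumes "x \<preceq> s" "y \<preceq> s" "\<And>z. \<lbrakk>z \<in> carrier G; x \<preceq> z; y \<preceq> z\<rbrakk> \<Longrightarrow> s \<preceq> z"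
    and "x \<in> carrier G" "y \<in> carrier G" "s \<in> carrier G"
  shows "x \<^bold>\<or> y = s"
  using assms by (intro le_antisym join_least) auto

lemma meet_unique:
  assumes "s \<preceq> x" "s \<preceq> y" "\<And>z. \<lbrakk>z \<in> carrier G; z \<preceq> x; z \<preceq> y\<rbrakk> \<Longrightarrow> z \<preceq> s"
    and "x \<in> carrier G" "y \<in> carrier G" "s \<in> carrier G"
  shows "x \<^bold>\<and> y = s"
  using assms by (intro le_antisym meet_greatest) auto

lemma meet_commute: "\<lbrakk>x \<in> carrier G; y \<in> carrier G\<rbrakk> \<Longrightarrow> x \<^bold>\<and> y = y \<^bold>\<and> x"
  by (intro le_antisym meet_greatest) auto

section \<open>Addition and the order\<close>

lemma add_minus_cancel [simp]: "\<lbrakk>x \<in> carrier G; y \<in> carrier G\<rbrakk> \<Longrightarrow> (x \<oplus> y) \<ominus> y = x"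
  by (simp add: minus_eq a_assoc r_neg)

lemma minus_add_cancel [simp]: "\<lbrakk>x \<in> carrier G; y \<in> carrier G\<rbrakk> \<Longrightarrow> (x \<ominus> y) \<oplus> y = x"
  by (simp add: minus_eq a_assoc l_neg)

lemma add_minus_left_cancel [simp]: "\<lbrakk>x \<in> carrier G; y \<in> carrier G\<rbrakk> \<Longrightarrow> y \<oplus> (x \<ominus> y) = x"
  by (simp add: a_comm[of y])

lemma minus_mono:
  "\<lbrakk>x \<preceq> y; x \<in> carrier G; y \<in> carrier G; z \<in> carrier G\<rbrakk> \<Longrightarrow> x \<ominus> z \<preceq> y \<ominus> z"
  by (simp add: minus_eq add_mono)

lemma add_diff_add:
  "\<lbrakk>w \<in> carrier G; x \<in> carrier G; y \<in> carrier G; z \<in> carrier G\<rbrakk> \<Longrightarrow>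
    (w \<oplus> x) \<ominus> (y \<oplus> z) = (w \<ominus> y) \<oplus> (x \<ominus> z)"
  by (simp add: minus_eq minus_add a_ac)

lemma le_minus_iff:
  "\<lbrakk>x \<in> carrier G; y \<in> carrier G; z \<in> carrier G\<rbrakk> \<Longrightarrow> x \<ominus> z \<preceq> y \<longleftrightarrow> x \<preceq> y \<oplus> z"
  using add_mono[of "x \<ominus> z" y z] add_mono[of x "y \<oplus> z" "\<ominus> z"]
  by (auto simp: minus_eq a_assoc l_neg r_neg)

lemma add_mono_both:
  assumes "x \<preceq> x'" "y \<preceq> y'" "x \<in> carrier G" "x' \<in> carrier G" "y \<in> carrier G" "y' \<in> carrier G"
  shows "x \<oplus> y \<preceq> x' \<oplus> y'"
proof (rule le_trans)
  show "x \<oplus> y \<preceq> x' \<oplus> y" using assms by (simp add: add_mono)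
  show "x' \<oplus> y \<preceq> x' \<oplus> y'"
    using assms add_mono[of y y' x'] by (simp add: a_comm[of x'])
qed (use assms in auto)

lemma diff_nonneg_iff:
  "\<lbrakk>x \<in> carrier G; y \<in> carrier G\<rbrakk> \<Longrightarrow> \<zero> \<preceq> y \<ominus> x \<longleftrightarrow> x \<preceq> y"
  using add_mono[of x y "\<ominus> x"] add_mono[of \<zero> "y \<ominus> x" x] by (auto simp: minus_eq r_neg a_assoc l_neg)

lemma neg_nonpos: "\<lbrakk>x \<in> carrier G; \<zero> \<preceq> x\<rbrakk> \<Longrightarrow> \<ominus> x \<preceq> \<zero>"
  using add_mono[of \<zero> x "\<ominus> x"] by (simp add: r_neg)

lemma add_nonneg:
  "\<lbrakk>\<zero> \<preceq> x; \<zero> \<preceq> y; x \<in> carrier G; y \<in> carrier G\<rbrakk> \<Longrightarrow> \<zero> \<preceq> x \<oplus> y"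
  using add_mono_both[of \<zero> x \<zero> y] by simp

lemma le_add_left: "\<lbrakk>\<zero> \<preceq> y; x \<in> carrier G; y \<in> carrier G\<rbrakk> \<Longrightarrow> x \<preceq> x \<oplus> y"
  using add_mono_both[of x x \<zero> y] by simp

lemma le_add_right: "\<lbrakk>\<zero> \<preceq> y; x \<in> carrier G; y \<in> carrier G\<rbrakk> \<Longrightarrow> x \<preceq> y \<oplus> x"
  using add_mono_both[of \<zero> y x x] by simp

section \<open>Positive parts\<close>

lemma pos_closed [simp]: "x \<in> carrier G \<Longrightarrow> pos x \<in> carrier G"
  by (simp add: pos_part_def)

lemma pos_nonneg [simp]: "x \<in> carrier G \<Longrightarrow> \<zero> \<preceq> pos x"
  by (simp add: pos_part_def)

lemma le_pos [simp]: "x \<in> carrier G \<Longrightarrow> x \<preceq> pos x"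
  by (simp add: pos_part_def)

lemma pos_least: "\<lbrakk>x \<preceq> y; \<zero> \<preceq> y; x \<in> carrier G; y \<in> carrier G\<rbrakk> \<Longrightarrow> pos x \<preceq> y"
  by (simp add: pos_part_def join_least)

lemma pos_mono: "\<lbrakk>x \<preceq> y; x \<in> carrier G; y \<in> carrier G\<rbrakk> \<Longrightarrow> pos x \<preceq> pos y"
  by (meson pos_least le_pos le_trans pos_closed pos_nonneg)

lemma pos_eq: "\<lbrakk>x \<in> carrier G; \<zero> \<preceq> x\<rbrakk> \<Longrightarrow> pos x = x"
  by (simp add: le_antisym pos_least)

lemma pos_eq_zero: "\<lbrakk>x \<in> carrier G; x \<preceq> \<zero>\<rbrakk> \<Longrightarrow> pos x = \<zero>"
  by (simp add: le_antisym pos_least)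

lemma pos_uminus:
  assumes "x \<in> carrier G"
  shows "pos (\<ominus> x) = pos x \<ominus> x"
proof (rule le_antisym)
  show "pos (\<ominus> x) \<preceq> pos x \<ominus> x"
    using assms add_mono[of \<zero> "pos x" "\<ominus> x"] by (intro pos_least) (auto simp: minus_eq diff_nonneg_iff[unfolded minus_eq])
  \<comment> \<open>Adding \<open>x\<close> to \<open>pos (\<ominus> x)\<close> gives an upper bound
    of zero and of \<open>x\<close>.\<close>
  have "\<zero> \<preceq> pos (\<ominus> x) \<oplus> x"
    using add_mono[of "\<ominus> x" "pos (\<ominus> x)" x] assms by (simp add: l_neg)
  moreover have "x \<preceq> pos (\<ominus> x) \<oplus> x"
    using assms by (simp add: le_add_right)
  ultimately show "pos x \<ominus> x \<preceq> pos (\<ominus> x)"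
    using assms by (simp add: le_minus_iff pos_least)
qed (use assms in auto)

lemma pos_minus_pos_uminus: "x \<in> carrier G \<Longrightarrow> pos x \<ominus> pos (\<ominus> x) = x"
  by (simp add: pos_uminus minus_eq minus_add a_assoc[symmetric] r_neg)

text \<open>Translation by \<open>y\<close> turns a join with \<open>y\<close> into a join with
  zero. Together with \<open>meet_eq_pos\<close> this reduces the lattice conditions on
  homomorphisms and subgroups to positive parts.\<close>

lemma join_eq_pos:
  assumes "x \<in> carrier G" "y \<in> carrier G"
  shows "x \<^bold>\<or> y = pos (x \<ominus> y) \<oplus> y"
proof (rule join_unique)
  show "x \<preceq> pos (x \<ominus> y) \<oplus> y"
    using assms le_minus_iff[of x "pos (x \<ominus> y)" y] by simp
  fix z assume "z \<in> carrier G" "x \<preceq> z" "y \<preceq> z"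
  then have "pos (x \<ominus> y) \<preceq> z \<ominus> y"
    using assms by (intro pos_least) (auto simp: diff_nonneg_iff minus_mono)
  then show "pos (x \<ominus> y) \<oplus> y \<preceq> z"
    using assms add_mono[of "pos (x \<ominus> y)" "z \<ominus> y" y] \<open>z \<in> carrier G\<close> by simp
qed (use assms in \<open>auto simp: le_add_right\<close>)

lemma meet_eq_pos:
  assumes "x \<in> carrier G" "y \<in> carrier G"
  shows "x \<^bold>\<and> y = x \<ominus> pos (x \<ominus> y)"
proof (rule meet_unique)
  show "x \<ominus> pos (x \<ominus> y) \<preceq> x"
    using assms by (simp add: le_minus_iff le_add_left)
  have "x \<preceq> pos (x \<ominus> y) \<oplus> y"
    using assms le_minus_iff[of x "pos (x \<ominus> y)" y] by simp
  then show "x \<ominus> pos (x \<ominus> y) \<preceq> y"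
    using assms by (simp add: le_minus_iff a_comm)
  fix z assume z: "z \<in> carrier G" "z \<preceq> x" "z \<preceq> y"
  \<comment> \<open>For a common lower bound \<open>z\<close>, the element
    \<open>x \<ominus> z\<close> is an upper bound of \<open>x \<ominus> y\<close> and of
    zero.\<close>
  have "x \<preceq> (x \<ominus> z) \<oplus> y"
    using add_mono[of z y "x \<ominus> z"] assms z by (simp add: a_comm)
  moreover have "\<zero> \<preceq> x \<ominus> z" using z assms by (simp add: diff_nonneg_iff)
  ultimately have "pos (x \<ominus> y) \<preceq> x \<ominus> z"
    using assms z by (intro pos_least) (auto simp: le_minus_iff)
  then have "pos (x \<ominus> y) \<oplus> z \<preceq> x"
    using assms z add_mono[of "pos (x \<ominus> y)" "x \<ominus> z" z] by simp
  then have "(pos (x \<ominus> y) \<oplus> z) \<ominus> pos (x \<ominus> y) \<preceq> x \<ominus> pos (x \<ominus> y)"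
    using assms z add_mono[of "pos (x \<ominus> y) \<oplus> z" x "\<ominus> pos (x \<ominus> y)"] by (simp add: minus_eq)
  then show "z \<preceq> x \<ominus> pos (x \<ominus> y)"
    using assms z by (simp add: a_comm[of _ z])
qed (use assms in auto)

lemma pos_add_le:
  "\<lbrakk>x \<in> carrier G; y \<in> carrier G\<rbrakk> \<Longrightarrow> pos (x \<oplus> y) \<preceq> pos x \<oplus> pos y"
  by (simp add: add_mono_both pos_least add_nonneg)

lemma pos_minus_pos_le:
  assumes "x \<in> carrier G" "y \<in> carrier G"
  shows "pos x \<ominus> pos y \<preceq> pos (x \<ominus> y)"
  using pos_add_le[of "x \<ominus> y" y] assms by (simp add: le_minus_iff)

lemma nat_mult_nonneg: "\<lbrakk>x \<in> carrier G; \<zero> \<preceq> x\<rbrakk> \<Longrightarrow> \<zero> \<preceq> [(n::nat)] \<cdot> x"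
  by (induction n) (auto simp: add_nonneg)

lemma nat_mult_mono: "\<lbrakk>x \<preceq> y; x \<in> carrier G; y \<in> carrier G\<rbrakk> \<Longrightarrow> [(n::nat)] \<cdot> x \<preceq> [n] \<cdot> y"
  by (induction n) (auto simp: add_mono_both)

section \<open>Disjoint elements\<close>

lemma disj_sym: "x \<bottom> y \<Longrightarrow> y \<bottom> x"
  using meet_commute by (auto simp: disj_def)

lemma disj_nonneg: "x \<bottom> y \<Longrightarrow> \<zero> \<preceq> x"
  unfolding disj_def using meet_left[of x y] by auto

lemma disj_nonneg2: "x \<bottom> y \<Longrightarrow> \<zero> \<preceq> y"
  by (rule disj_nonneg[OF disj_sym])

text \<open>Nonnegative lower bounds suffice as tests, because the meet of two nonnegative elements
  is one of them.\<close>

lemma disjI: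
  assumes "\<And>z. \<lbrakk>z \<in> carrier G; \<zero> \<preceq> z; z \<preceq> x; z \<preceq> y\<rbrakk> \<Longrightarrow> z \<preceq> \<zero>"
    and "\<zero> \<preceq> x" "\<zero> \<preceq> y" "x \<in> carrier G" "y \<in> carrier G"
  shows "x \<bottom> y"
proof -
  have "\<zero> \<preceq> x \<^bold>\<and> y" using assms by (simp add: meet_greatest)
  then show ?thesis using assms by (auto simp: disj_def intro: le_antisym)
qed

lemma disjD: "\<lbrakk>x \<bottom> y; z \<preceq> x; z \<preceq> y; z \<in> carrier G\<rbrakk> \<Longrightarrow> z \<preceq> \<zero>"
  unfolding disj_def using meet_greatest[of z x y] by auto

lemma disj_mono:
  assumes "x \<bottom> y" "\<zero> \<preceq> x'" "x' \<preceq> x" "x' \<in> carrier G"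
  shows "x' \<bottom> y"
proof (rule disjI)
  fix z assume z: "z \<in> carrier G" "\<zero> \<preceq> z" "z \<preceq> x'" "z \<preceq> y"
  have "x \<in> carrier G" using assms(1) by (simp add: disj_def)
  then have "z \<preceq> x" using z assms(3,4) le_trans by blast
  then show "z \<preceq> \<zero>" using assms(1) z disjD by blast
next
  show "\<zero> \<preceq> y" "y \<in> carrier G"
    using assms(1) disj_nonneg2 by (blast, simp add: disj_def)
qed (use assms in auto)

lemma disj_mono2:
  assumes "x \<bottom> y" "\<zero> \<preceq> x'" "x' \<preceq> x" "x' \<in> carrier G" "\<zero> \<preceq> y'" "y' \<preceq> y" "y' \<in> carrier G"
  shows "x' \<bottom> y'"
  by (rule disj_sym[OF disj_mono[OF disj_sym[OF disj_mono[OF assms(1-4)]] assms(5-7)]])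

lemma disj_add:
  assumes "x \<bottom> z" "y \<bottom> z"
  shows "x \<oplus> y \<bottom> z"
proof -
  have c: "x \<in> carrier G" "y \<in> carrier G" "z \<in> carrier G" using assms by (auto simp: disj_def)
  have nn: "\<zero> \<preceq> x" "\<zero> \<preceq> y" "\<zero> \<preceq> z"
    using assms disj_nonneg disj_nonneg2 by blast+
  show ?thesis
  proof (rule disjI)
    fix w assume w: "w \<in> carrier G" "\<zero> \<preceq> w" "w \<preceq> x \<oplus> y" "w \<preceq> z"
    \<comment> \<open>The difference \<open>w \<ominus> x\<close> lies below \<open>y\<close> and
      below \<open>z\<close>, hence below zero, which puts \<open>w\<close> below \<open>x\<close>
      as well.\<close>
    have "w \<ominus> x \<preceq> y" using w c by (simp add: le_minus_iff a_comm)
    moreover have "w \<ominus> x \<preceq> z"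
      using w c nn le_trans[OF w(4) le_add_left[of x z]] by (simp add: le_minus_iff)
    ultimately have "w \<ominus> x \<preceq> \<zero>" using disjD[OF assms(2)] w c by simp
    then have "w \<preceq> x" using w c by (simp add: le_minus_iff)
    then show "w \<preceq> \<zero>" using disjD[OF assms(1)] w by simp
  qed (use c nn in \<open>auto simp: add_nonneg\<close>)
qed

lemma zero_disj: "\<lbrakk>x \<in> carrier G; \<zero> \<preceq> x\<rbrakk> \<Longrightarrow> \<zero> \<bottom> x"
  by (rule disjI) auto

lemma disj_nat_mult: "x \<bottom> y \<Longrightarrow> [(n::nat)] \<cdot> x \<bottom> y"
proof (induction n)
  case 0
  then have "y \<in> carrier G" "\<zero> \<preceq> y" using disj_nonneg2 by (simp add: disj_def, blast)
  then show ?case by (simp add: zero_disj)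
qed (auto intro: disj_add)

lemma disj_nat_mult_both: "x \<bottom> y \<Longrightarrow> [(n::nat)] \<cdot> x \<bottom> [(m::nat)] \<cdot> y"
  by (rule disj_nat_mult[OF disj_sym[OF disj_nat_mult[OF disj_sym]]])

lemma disj_self: "x \<bottom> x \<Longrightarrow> x = \<zero>"
  using disjD[of x x x] disj_nonneg[of x x] by (auto simp: disj_def intro: le_antisym)

text \<open>Subtracting a common lower bound \<open>z\<close> from \<open>pos x\<close> leaves an
  upper bound of \<open>x\<close> and of zero; minimality of \<open>pos x\<close> forces
  \<open>z\<close> to be nonpositive.\<close>

lemma pos_disj_pos_uminus:
  assumes "x \<in> carrier G"
  shows "pos x \<bottom> pos (\<ominus> x)"
proof (rule disjI)
  fix z assume z: "z \<in> carrier G" "\<zero> \<preceq> z" "z \<preceq> pos x" "z \<preceq> pos (\<ominus> x)"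
  have "z \<oplus> x \<preceq> pos x"
    using z assms add_mono[of z "pos x \<ominus> x" x] by (simp add: pos_uminus)
  then have "x \<preceq> pos x \<ominus> z"
    using z assms add_mono[of "z \<oplus> x" "pos x" "\<ominus> z"] by (simp add: minus_eq a_comm[of z x] a_assoc r_neg)
  moreover have "\<zero> \<preceq> pos x \<ominus> z" using z assms by (simp add: diff_nonneg_iff)
  ultimately have "pos x \<preceq> pos x \<ominus> z" using z assms by (simp add: pos_least)
  then have "pos x \<oplus> z \<preceq> \<zero> \<oplus> pos x"
    using z assms add_mono[of "pos x" "pos x \<ominus> z" z] by simp
  then have "(pos x \<oplus> z) \<ominus> pos x \<preceq> \<zero>" using z assms by (simp add: le_minus_iff)
  then show "z \<preceq> \<zero>" using z assms by (simp add: a_comm[of _ z])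
qed (use assms in auto)

text \<open>Complements \<open>pos_disj_pos_uminus\<close>: writing an element as a difference of
  disjoint elements is possible only with its positive and negative parts.\<close>

lemma pos_minus_disj:
  assumes "x \<bottom> y"
  shows "pos (x \<ominus> y) = x"
proof -
  have c: "x \<in> carrier G" "y \<in> carrier G" using assms by (auto simp: disj_def)
  have "x \<^bold>\<and> y = \<zero>" using assms by (simp add: disj_def)
  then have "x \<ominus> pos (x \<ominus> y) = \<zero>" using c by (simp add: meet_eq_pos)
  then have "(x \<ominus> pos (x \<ominus> y)) \<oplus> pos (x \<ominus> y) = \<zero> \<oplus> pos (x \<ominus> y)" by simp
  then show ?thesis using c by simp
qed

lemma pos_le_disj_pos:
  assumes "x \<in> carrier G" "y \<in> carrier G" "x \<preceq> \<ominus> y"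
  shows "pos x \<bottom> pos y"
  by (rule disj_mono2[OF pos_disj_pos_uminus[of "\<ominus> y"]]) (use assms in \<open>auto simp: pos_mono\<close>)

text \<open>An error bound \<open>y\<close> for \<open>x\<close> remains an error bound for
  \<open>pos x\<close>, since \<open>pos (x \<ominus> y) \<oplus> y\<close> dominates both
  \<open>x\<close> and zero.\<close>

lemma pos_pos_minus_le:
  assumes "x \<in> carrier G" "y \<in> carrier G" "\<zero> \<preceq> y"
  shows "pos (pos x \<ominus> y) \<preceq> pos (x \<ominus> y)"
proof (rule pos_least)
  have "x \<preceq> pos (x \<ominus> y) \<oplus> y"
    using assms le_minus_iff[of x "pos (x \<ominus> y)" y] by simp
  then have "pos x \<preceq> pos (x \<ominus> y) \<oplus> y"
    using assms by (simp add: pos_least add_nonneg)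
  then show "pos x \<ominus> y \<preceq> pos (x \<ominus> y)"
    using assms by (simp add: le_minus_iff)
qed (use assms in auto)

lemma disj_pos_le:
  assumes "y \<bottom> w" "x \<preceq> y" "x \<in> carrier G"
  shows "pos x \<bottom> w"
proof -
  have "y \<in> carrier G" "\<zero> \<preceq> y" using assms(1) disj_nonneg by (auto simp: disj_def)
  then show ?thesis by (intro disj_mono[OF assms(1)]) (use assms in \<open>auto intro: pos_least\<close>)
qed

lemma le_add_meet:
  assumes "w \<preceq> p \<oplus> q" "\<zero> \<preceq> p" "w \<in> carrier G" "p \<in> carrier G" "q \<in> carrier G"
  shows "w \<preceq> p \<oplus> (w \<^bold>\<and> q)"
proof -
  have "w \<ominus> p \<preceq> w \<^bold>\<and> q"
    using assms by (intro meet_greatest) (auto simp: le_minus_iff a_comm[of q] le_add_left)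
  then show ?thesis using assms by (simp add: le_minus_iff a_comm[of p])
qed

text \<open>The summand \<open>q\<close> cannot contribute to \<open>v\<close>, which lies below
  \<open>y\<close>. Concretely, a nonnegative \<open>z\<close> below \<open>v\<close> and
  \<open>w\<close> is disjoint from \<open>p\<close> because of \<open>w\<close> and from
  \<open>q\<close> because of \<open>y\<close>, hence from their sum, which lies above
  \<open>z\<close> itself.\<close>

lemma disj_split:
  assumes "p \<bottom> w" "q \<bottom> y" "\<zero> \<preceq> v" "v \<preceq> p \<oplus> q" "v \<preceq> y" "v \<in> carrier G"
  shows "v \<bottom> w"
proof (rule disjI)
  have c: "p \<in> carrier G" "q \<in> carrier G" "y \<in> carrier G" using assms by (auto simp: disj_def)
  show "\<zero> \<preceq> w" "w \<in> carrier G" using disj_nonneg2[OF assms(1)] assms(1) by (auto simp: disj_def)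
  fix z assume z: "z \<in> carrier G" "\<zero> \<preceq> z" "z \<preceq> v" "z \<preceq> w"
  have "z \<bottom> p" by (rule disj_mono[OF disj_sym[OF assms(1)]]) (use z in auto)
  moreover have "z \<preceq> y" by (rule le_trans[OF z(3) assms(5)]) (use z c assms in auto)
  then have "z \<bottom> q" by (intro disj_mono[OF disj_sym[OF assms(2)]]) (use z in auto)
  ultimately have "p \<oplus> q \<bottom> z" by (intro disj_add) (auto intro: disj_sym)
  moreover have "z \<preceq> p \<oplus> q" by (rule le_trans[OF z(3) assms(4)]) (use z c assms in auto)
  ultimately have "z = \<zero>" using z by (intro disj_self) (rule disj_mono)
  then show "z \<preceq> \<zero>" by simp
qed (use assms in auto)

text \<open>The meet is a hat function centred where \<open>x\<close> vanishes and supported where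
  the absolute value of \<open>x\<close> is below \<open>d\<close>. Pointwise, the meet is the left
  side where \<open>x\<close> is nonnegative, and elsewhere \<open>d \<ominus> x\<close> exceeds
  \<open>d \<oplus> x\<close> by twice the negative part of \<open>x\<close>. With \<open>d\<close>
  equal to 1 this is the induction step in \<open>act_disj\<close>.\<close>

lemma hat_cover:
  assumes c: "x \<in> carrier G" "d \<in> carrier G"
  shows "pos (d \<ominus> x) \<preceq> pos (\<ominus> x) \<oplus> pos (\<ominus> x) \<oplus> (pos (d \<ominus> x) \<^bold>\<and> pos (d \<oplus> x))"
proof (rule le_add_meet)
  have "\<ominus> x \<oplus> \<ominus> x \<oplus> (d \<oplus> x) = (\<ominus> x \<oplus> (\<ominus> x \<oplus> x)) \<oplus> d"
    using c by (simp only: a_ac a_closed a_inv_closed)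
  then have "d \<ominus> x = \<ominus> x \<oplus> \<ominus> x \<oplus> (d \<oplus> x)"
    using c by (simp add: minus_eq a_comm l_neg r_neg)
  then have "pos (d \<ominus> x) \<preceq> pos (\<ominus> x \<oplus> \<ominus> x) \<oplus> pos (d \<oplus> x)"
    using c pos_add_le[of "\<ominus> x \<oplus> \<ominus> x" "d \<oplus> x"] by simp
  moreover have "pos (\<ominus> x \<oplus> \<ominus> x) \<oplus> pos (d \<oplus> x) \<preceq> pos (\<ominus> x) \<oplus> pos (\<ominus> x) \<oplus> pos (d \<oplus> x)"
    using c by (intro add_mono pos_add_le) auto
  ultimately show "pos (d \<ominus> x) \<preceq> pos (\<ominus> x) \<oplus> pos (\<ominus> x) \<oplus> pos (d \<oplus> x)"
    by (rule le_trans) (use c in auto)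
qed (use c in \<open>auto simp: add_nonneg\<close>)

end

subsection \<open>Homomorphisms and subgroups\<close>

abbreviation add_hom :: "('a, 'm) lring_scheme \<Rightarrow> ('b, 'n) lring_scheme \<Rightarrow> ('a \<Rightarrow> 'b) set" where
  "add_hom G H \<equiv> hom (add_monoid G) (add_monoid H)"

lemma add_hom_closed: "\<lbrakk>f \<in> add_hom G H; x \<in> carrier G\<rbrakk> \<Longrightarrow> f x \<in> carrier H"
  by (auto simp: hom_def)

lemma add_hom_add:
  "\<lbrakk>f \<in> add_hom G H; x \<in> carrier G; y \<in> carrier G\<rbrakk> \<Longrightarrow> f (x \<oplus>\<^bsub>G\<^esub> y) = f x \<oplus>\<^bsub>H\<^esub> f y"
  by (auto simp: hom_def)

lemma add_homI:
  assumes "\<And>x. x \<in> carrier G \<Longrightarrow> f x \<in> carrier H"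
    and "\<And>x y. \<lbrakk>x \<in> carrier G; y \<in> carrier G\<rbrakk> \<Longrightarrow> f (x \<oplus>\<^bsub>G\<^esub> y) = f x \<oplus>\<^bsub>H\<^esub> f y"
  shows "f \<in> add_hom G H"
  using assms by (auto simp: hom_def)

lemma add_hom_comp: "\<lbrakk>f \<in> add_hom G H; g \<in> add_hom H K\<rbrakk> \<Longrightarrow> (\<lambda>x. g (f x)) \<in> add_hom G K"
  by (auto simp: hom_def Pi_def)

lemma l_hom_imp_add_hom: "f \<in> l_hom G H \<Longrightarrow> f \<in> add_hom G H"
  by (simp add: l_hom_def)

lemma l_hom_comp: "\<lbrakk>f \<in> l_hom G H; g \<in> l_hom H K\<rbrakk> \<Longrightarrow> (\<lambda>x. g (f x)) \<in> l_hom G K"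
  by (auto simp: l_hom_def hom_def Pi_def)

lemma l_hom_closed: "\<lbrakk>f \<in> l_hom G H; x \<in> carrier G\<rbrakk> \<Longrightarrow> f x \<in> carrier H"
  by (rule add_hom_closed[OF l_hom_imp_add_hom])

locale l_group_pair = G: l_group G + H: l_group H
  for G :: "('a, 'm) lring_scheme" and H :: "('b, 'n) lring_scheme"
begin

lemma add_hom_zero:
  assumes "f \<in> add_hom G H"
  shows "f \<zero>\<^bsub>G\<^esub> = \<zero>\<^bsub>H\<^esub>"
proof -
  interpret group_hom "add_monoid G" "add_monoid H" f
    using assms by (intro group_hom.intro group_hom_axioms.intro G.a_group H.a_group)
  show ?thesis using hom_one by simp
qed

lemma add_hom_uminus:
  assumes "f \<in> add_hom G H" "x \<in> carrier G"
  shows "f (\<ominus>\<^bsub>G\<^esub> x) = \<ominus>\<^bsub>H\<^esub> f x"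
proof -
  interpret group_hom "add_monoid G" "add_monoid H" f
    using assms by (intro group_hom.intro group_hom_axioms.intro G.a_group H.a_group)
  show ?thesis using hom_inv assms by (simp add: a_inv_def)
qed

lemma add_hom_minus:
  "\<lbrakk>f \<in> add_hom G H; x \<in> carrier G; y \<in> carrier G\<rbrakk> \<Longrightarrow> f (x \<ominus>\<^bsub>G\<^esub> y) = f x \<ominus>\<^bsub>H\<^esub> f y"
  by (simp add: G.minus_eq H.minus_eq add_hom_add add_hom_uminus)

lemma add_hom_nat_mult:
  "\<lbrakk>f \<in> add_hom G H; x \<in> carrier G\<rbrakk> \<Longrightarrow> f ([(n::nat)] \<cdot>\<^bsub>G\<^esub> x) = [n] \<cdot>\<^bsub>H\<^esub> f x"
  by (induction n) (simp_all add: add_hom_add add_hom_zero)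

lemma l_hom_pos:
  assumes "f \<in> l_hom G H" "x \<in> carrier G"
  shows "f (pos\<^bsub>G\<^esub> x) = pos\<^bsub>H\<^esub> (f x)"
  using assms by (simp add: pos_part_def l_hom_def add_hom_zero)

lemma l_homI:
  assumes hom: "f \<in> add_hom G H"
    and pos: "\<And>x. x \<in> carrier G \<Longrightarrow> f (pos\<^bsub>G\<^esub> x) = pos\<^bsub>H\<^esub> (f x)"
  shows "f \<in> l_hom G H"
  using hom by (auto simp: l_hom_def G.join_eq_pos H.join_eq_pos G.meet_eq_pos H.meet_eq_pos
      add_hom_closed add_hom_add add_hom_minus pos)

lemma l_hom_nonneg:
  "\<lbrakk>f \<in> l_hom G H; x \<in> carrier G; \<zero>\<^bsub>G\<^esub> \<preceq>\<^bsub>G\<^esub> x\<rbrakk> \<Longrightarrow> \<zero>\<^bsub>H\<^esub> \<preceq>\<^bsub>H\<^esub> f x"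
  using l_hom_pos[of f x] H.pos_nonneg[of "f x"] by (simp add: G.pos_eq l_hom_closed)

lemma l_hom_mono:
  assumes "f \<in> l_hom G H" "x \<in> carrier G" "y \<in> carrier G" "x \<preceq>\<^bsub>G\<^esub> y"
  shows "f x \<preceq>\<^bsub>H\<^esub> f y"
  using l_hom_nonneg[of f "y \<ominus>\<^bsub>G\<^esub> x"] assms
  by (simp add: G.diff_nonneg_iff H.diff_nonneg_iff add_hom_minus l_hom_imp_add_hom l_hom_closed)

lemma l_hom_disj:
  assumes "f \<in> l_hom G H" "disj G x y"
  shows "disj H (f x) (f y)"
proof -
  have "x \<in> carrier G" "y \<in> carrier G" using assms(2) by (auto simp: disj_def)
  then have "f (lmeet G x y) = lmeet H (f x) (f y)"
    using assms(1) by (simp add: l_hom_def)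
  then show ?thesis
    using assms(2) add_hom_zero[OF l_hom_imp_add_hom[OF assms(1)]]
    by (simp add: disj_def l_hom_closed[OF assms(1)])
qed

text \<open>The image of \<open>x\<close> is the difference of the images of its two parts. If these
  are disjoint, they are the parts of \<open>f x\<close> by \<open>pos_minus_disj\<close>, so
  positive parts are preserved.\<close>

lemma l_homI_disj:
  assumes hom: "f \<in> add_hom G H"
    and disj: "\<And>x y. disj G x y \<Longrightarrow> disj H (f x) (f y)"
  shows "f \<in> l_hom G H"
proof (rule l_homI[OF hom])
  fix x assume x: "x \<in> carrier G"
  let ?m = "pos\<^bsub>G\<^esub> (\<ominus>\<^bsub>G\<^esub> x)"
  have "f x = f (pos\<^bsub>G\<^esub> x \<ominus>\<^bsub>G\<^esub> ?m)" using x by (simp add: G.pos_minus_pos_uminus)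
  also have "\<dots> = f (pos\<^bsub>G\<^esub> x) \<ominus>\<^bsub>H\<^esub> f ?m" using x hom by (simp add: add_hom_minus)
  finally show "f (pos\<^bsub>G\<^esub> x) = pos\<^bsub>H\<^esub> (f x)"
    using H.pos_minus_disj[OF disj[OF G.pos_disj_pos_uminus[OF x]]] by simp
qed

end

lemma (in l_group) nat_mult_l_hom: "(\<lambda>x. [(n::nat)] \<cdot> x) \<in> l_hom G G"
proof -
  interpret l_group_pair G G ..
  show ?thesis
    by (rule l_homI_disj) (auto intro!: add_homI simp: disj_nat_mult_both add.nat_pow_distrib)
qed

section \<open>Subgroups closed under the lattice operations, and their copies as test
  objects\<close>

locale l_subgroup = l_group +
  fixes S
  assumes subset: "S \<subseteq> carrier G"
    and zero_mem: "\<zero> \<in> S"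
    and add_mem: "\<lbrakk>x \<in> S; y \<in> S\<rbrakk> \<Longrightarrow> x \<oplus> y \<in> S"
    and uminus_mem: "x \<in> S \<Longrightarrow> \<ominus> x \<in> S"
    and pos_mem: "x \<in> S \<Longrightarrow> pos x \<in> S"
begin

lemma mem_carrier [simp]: "x \<in> S \<Longrightarrow> x \<in> carrier G"
  using subset by auto

lemma minus_mem: "\<lbrakk>x \<in> S; y \<in> S\<rbrakk> \<Longrightarrow> x \<ominus> y \<in> S"
  by (simp add: minus_eq add_mem uminus_mem)

end

text \<open>Test objects of the universal property of \<open>T\<close> live in a sum type that has the type of \<open>T\<close> as
  its right summand.\<close>

definition sub_copy :: "('a, 'm) lring_scheme \<Rightarrow> 'a set \<Rightarrow> ('x + 'a) lring" where
  "sub_copy G S = \<lparr>carrier = Inr ` S, monoid.mult = (\<lambda>_. undefined), one = undefined, ring.zero = Inr \<zero>\<^bsub>G\<^esub>,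
     ring.add = (\<lambda>x y. Inr (projr x \<oplus>\<^bsub>G\<^esub> projr y)), leq = (\<lambda>x y. projr x \<preceq>\<^bsub>G\<^esub> projr y)\<rparr>"

context l_subgroup
begin

lemma sub_copy_simps:
  "carrier (sub_copy G S) = Inr ` S"
  "ring.zero (sub_copy G S) = Inr \<zero>"
  "ring.add (sub_copy G S) (Inr x) (Inr y) = Inr (x \<oplus> y)"
  "lring.leq (sub_copy G S) (Inr x) (Inr y) \<longleftrightarrow> x \<preceq> y"
  by (simp_all add: sub_copy_def)

lemma l_group_sub_copy: "l_group (sub_copy G S :: ('x + 'a) lring)" (is "l_group ?C")
proof (rule l_groupI)
  show "abelian_group ?C"
    by (rule abelian_groupI)
      (auto simp: sub_copy_simps add_mem zero_mem a_ac r_neg intro!: bexI[OF _ uminus_mem])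
next
  fix x y assume "x \<in> carrier ?C" "y \<in> carrier ?C"
  then obtain a b where ab: "x = Inr a" "y = Inr b" "a \<in> S" "b \<in> S"
    by (auto simp: sub_copy_simps)
  have "a \<^bold>\<or> b \<in> S" "a \<^bold>\<and> b \<in> S"
    using ab by (simp_all add: join_eq_pos meet_eq_pos pos_mem add_mem minus_mem)
  then show "\<exists>s \<in> carrier ?C. x \<preceq>\<^bsub>?C\<^esub> s \<and> y \<preceq>\<^bsub>?C\<^esub> s \<and>
       (\<forall>z \<in> carrier ?C. x \<preceq>\<^bsub>?C\<^esub> z \<longrightarrow> y \<preceq>\<^bsub>?C\<^esub> z \<longrightarrow> s \<preceq>\<^bsub>?C\<^esub> z)"
    using ab by (intro bexI[of _ "Inr (a \<^bold>\<or> b)"]) (auto simp: sub_copy_simps join_least)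
  show "\<exists>s \<in> carrier ?C. s \<preceq>\<^bsub>?C\<^esub> x \<and> s \<preceq>\<^bsub>?C\<^esub> y \<and>
       (\<forall>z \<in> carrier ?C. z \<preceq>\<^bsub>?C\<^esub> x \<longrightarrow> z \<preceq>\<^bsub>?C\<^esub> y \<longrightarrow> z \<preceq>\<^bsub>?C\<^esub> s)"
    using ab \<open>a \<^bold>\<and> b \<in> S\<close>
    by (intro bexI[of _ "Inr (a \<^bold>\<and> b)"]) (auto simp: sub_copy_simps meet_greatest)
qed (auto simp: sub_copy_simps add_mono intro: le_antisym le_trans[OF _ _ mem_carrier mem_carrier mem_carrier])

text \<open>Transfers the archimedean property, which for the copy speaks of multiples formed in the
  copy.\<close>

lemma nat_mult_sub_copy: "x \<in> S \<Longrightarrow> [(n::nat)] \<cdot> x \<in> S \<and> [n] \<cdot>\<^bsub>(sub_copy G S :: ('x + 'a) lring)\<^esub> (Inr x) = Inr ([n] \<cdot> x)"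
proof (induction n)
  case 0
  interpret C: l_group "sub_copy G S :: ('x + 'a) lring" by (rule l_group_sub_copy)
  have "[(0::nat)] \<cdot>\<^bsub>(sub_copy G S :: ('x + 'a) lring)\<^esub> (Inr x) = Inr \<zero>" by (simp add: sub_copy_simps)
  then show ?case by (simp add: sub_copy_simps zero_mem)
next
  case (Suc n)
  interpret C: l_group "sub_copy G S :: ('x + 'a) lring" by (rule l_group_sub_copy)
  have "[Suc n] \<cdot>\<^bsub>(sub_copy G S :: ('x + 'a) lring)\<^esub> (Inr x) = [n] \<cdot>\<^bsub>sub_copy G S\<^esub> (Inr x) \<oplus>\<^bsub>sub_copy G S\<^esub> Inr x"
    by (rule C.add.nat_pow_Suc)
  then show ?case using Suc by (simp add: sub_copy_simps add_mem)
qed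

lemma archimedean_sub_copy:
  assumes "archimedean G"
  shows "archimedean (sub_copy G S)"
  using assms by (fastforce simp: archimedean_def sub_copy_simps nat_mult_sub_copy)

lemma pos_sub_copy:
  assumes "x \<in> S"
  shows "pos\<^bsub>(sub_copy G S :: ('x + 'a) lring)\<^esub> (Inr x) = Inr (pos x)"
proof -
  interpret C: l_group "sub_copy G S :: ('x + 'a) lring" by (rule l_group_sub_copy)
  show ?thesis
    unfolding pos_part_def[of "sub_copy G S :: ('x + 'a) lring"] using assms
    by (intro C.join_unique) (auto simp: sub_copy_simps pos_mem zero_mem pos_least)
qed

lemma projr_l_hom: "projr \<in> l_hom (sub_copy G S :: ('x + 'a) lring) G"
proof -
  interpret C: l_group "sub_copy G S :: ('x + 'a) lring" by (rule l_group_sub_copy)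
  interpret l_group_pair "sub_copy G S :: ('x + 'a) lring" G ..
  show ?thesis
    by (intro l_homI add_homI) (auto simp: sub_copy_simps pos_sub_copy)
qed

lemma Inr_comp_add_hom:
  assumes "f \<in> add_hom K G" "\<And>x. x \<in> carrier K \<Longrightarrow> f x \<in> S"
  shows "(\<lambda>x. Inr (f x)) \<in> add_hom K (sub_copy G S)"
  using assms by (intro add_homI) (auto simp: sub_copy_simps add_hom_add)

lemma Inr_comp_l_hom:
  assumes "l_group K" "f \<in> l_hom K G" "\<And>x. x \<in> carrier K \<Longrightarrow> f x \<in> S"
  shows "(\<lambda>x. Inr (f x)) \<in> l_hom K (sub_copy G S :: ('x + 'a) lring)"
proof -
  interpret C: l_group "sub_copy G S :: ('x + 'a) lring" by (rule l_group_sub_copy)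
  interpret K: l_group K by fact
  interpret l_group_pair K "sub_copy G S :: ('x + 'a) lring" ..
  interpret KG: l_group_pair K G ..
  show ?thesis
    using assms by (intro l_homI Inr_comp_add_hom) (auto simp: pos_sub_copy KG.l_hom_pos l_hom_imp_add_hom)
qed

end

lemma l_subgroup_carrier: "l_group G \<Longrightarrow> l_subgroup G (carrier G)"
  by (simp add: l_subgroup_def l_subgroup_axioms_def l_group.pos_closed abelian_group.a_inv_closed
     l_group.axioms(1) abelian_groupE)

subsection \<open>The archimedean tensor product\<close>

lemma l_bilinearD:
  assumes "l_bilinear G H K b"
  shows "x \<in> carrier G \<Longrightarrow> b x \<in> add_hom H K"
    and "y \<in> carrier H \<Longrightarrow> (\<lambda>x. b x y) \<in> add_hom G K"
    and "\<lbrakk>x \<in> carrier G; \<zero>\<^bsub>G\<^esub> \<preceq>\<^bsub>G\<^esub> x\<rbrakk> \<Longrightarrow> b x \<in> l_hom H K"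
    and "\<lbrakk>y \<in> carrier H; \<zero>\<^bsub>H\<^esub> \<preceq>\<^bsub>H\<^esub> y\<rbrakk> \<Longrightarrow> (\<lambda>x. b x y) \<in> l_hom G K"
  using assms by (auto simp: l_bilinear_def)

lemma l_bilinear_comp:
  assumes b: "l_bilinear G H K b" and f: "f \<in> l_hom K L"
  shows "l_bilinear G H L (\<lambda>x y. f (b x y))"
  unfolding l_bilinear_def
proof (intro conjI ballI impI)
  fix x assume x: "x \<in> carrier G"
  show "(\<lambda>y. f (b x y)) \<in> add_hom H L"
    by (rule add_hom_comp[OF l_bilinearD(1)[OF b x] l_hom_imp_add_hom[OF f]])
  assume "\<zero>\<^bsub>G\<^esub> \<preceq>\<^bsub>G\<^esub> x"
  then show "(\<lambda>y. f (b x y)) \<in> l_hom H L"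
    by (rule l_hom_comp[OF l_bilinearD(3)[OF b x] f])
next
  fix y assume y: "y \<in> carrier H"
  show "(\<lambda>x. f (b x y)) \<in> add_hom G L"
    by (rule add_hom_comp[OF l_bilinearD(2)[OF b y] l_hom_imp_add_hom[OF f]])
  assume "\<zero>\<^bsub>H\<^esub> \<preceq>\<^bsub>H\<^esub> y"
  then show "(\<lambda>x. f (b x y)) \<in> l_hom G L"
    by (rule l_hom_comp[OF l_bilinearD(4)[OF b y] f])
qed

locale archimedean_tensor_product = A: l_group A + B: l_group B + T: l_group T
  for A :: "('a, 'm) lring_scheme" and B :: "('b, 'n) lring_scheme" and T :: "('c, 'l) lring_scheme" +
  fixes t :: "'a \<Rightarrow> 'b \<Rightarrow> 'c"
  assumes tensor: "archimedean_tensor A B T t"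

sublocale archimedean_tensor_product \<subseteq> TT: l_group_pair T T ..
sublocale archimedean_tensor_product \<subseteq> AT: l_group_pair A T ..
sublocale archimedean_tensor_product \<subseteq> BT: l_group_pair B T ..

context archimedean_tensor_product
begin

lemma t_bilinear: "l_bilinear A B T t"
  using tensor by (simp add: archimedean_tensor_def)

lemmas t_hom1 = l_bilinearD(2)[OF t_bilinear]
  and t_hom2 = l_bilinearD(1)[OF t_bilinear]
  and t_l_hom1 = l_bilinearD(4)[OF t_bilinear]
  and t_l_hom2 = l_bilinearD(3)[OF t_bilinear]

lemma t_closed [simp]: "\<lbrakk>x \<in> carrier A; y \<in> carrier B\<rbrakk> \<Longrightarrow> t x y \<in> carrier T"
  using add_hom_closed[OF t_hom2] by blast

lemma l_bilinear_sub_copy: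
  assumes "l_subgroup T S" and b: "l_bilinear A B T b"
    and S: "\<And>x y. \<lbrakk>x \<in> carrier A; y \<in> carrier B\<rbrakk> \<Longrightarrow> b x y \<in> S"
  shows "l_bilinear A B (sub_copy T S) (\<lambda>x y. Inr (b x y))"
proof -
  interpret S: l_subgroup T S by fact
  show ?thesis
    unfolding l_bilinear_def using b S
    by (auto simp: l_bilinear_def intro!: S.Inr_comp_add_hom S.Inr_comp_l_hom A.l_group_axioms B.l_group_axioms)
qed

lemma universal:
  fixes K :: "(('a \<times> 'b) list + 'c) lring"
  assumes "l_group K" "archimedean K" "l_bilinear A B K b"
  shows "\<exists>f \<in> l_hom T K. (\<forall>x \<in> carrier A. \<forall>y \<in> carrier B. f (t x y) = b x y) \<and>
    (\<forall>f' \<in> l_hom T K. (\<forall>x \<in> carrier A. \<forall>y \<in> carrier B. f' (t x y) = b x y) \<longrightarrow>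
      (\<forall>z \<in> carrier T. f' z = f z))"
  using tensor assms unfolding archimedean_tensor_def universal_l_bilinear_def by simp

lemma archimedean_T: "archimedean T"
  using tensor by (simp add: archimedean_tensor_def)

text \<open>The existence half for maps into \<open>T\<close>. Factoring through the copy of
  \<open>S\<close> and returning by \<open>projr\<close> records in addition that the extension
  takes its values in \<open>S\<close>.\<close>

lemma extension:
  assumes "l_subgroup T S" and b: "l_bilinear A B T b"
    and S: "\<And>x y. \<lbrakk>x \<in> carrier A; y \<in> carrier B\<rbrakk> \<Longrightarrow> b x y \<in> S"
  obtains f where "f \<in> l_hom T T" "\<And>x y. \<lbrakk>x \<in> carrier A; y \<in> carrier B\<rbrakk> \<Longrightarrow> f (t x y) = b x y"
    "\<And>x. x \<in> carrier T \<Longrightarrow> f x \<in> S"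
proof -
  interpret S: l_subgroup T S by fact
  let ?C = "sub_copy T S :: (('a \<times> 'b) list + 'c) lring"
  have bil: "l_bilinear A B ?C (\<lambda>x y. Inr (b x y))"
    by (rule l_bilinear_sub_copy) (fact assms)+
  obtain f where f: "f \<in> l_hom T ?C"
      "\<And>x y. \<lbrakk>x \<in> carrier A; y \<in> carrier B\<rbrakk> \<Longrightarrow> f (t x y) = Inr (b x y)"
    using universal[OF S.l_group_sub_copy S.archimedean_sub_copy[OF archimedean_T] bil]
    by (elim bexE conjE) (rule that, auto)
  show thesis
  proof (rule that)
    show "(\<lambda>x. projr (f x)) \<in> l_hom T T"
      by (rule l_hom_comp[OF f(1) S.projr_l_hom])
    show "projr (f x) \<in> S" if "x \<in> carrier T" for x
      using l_hom_closed[OF f(1) that] by (auto simp: S.sub_copy_simps)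
  qed (simp add: f(2))
qed

text \<open>The uniqueness half for maps into \<open>T\<close>. Moved into the copy of
  \<open>T\<close>, both maps extend the same bilinear map and so agree with the extension
  \<open>h\<close>.\<close>

lemma l_hom_eqI:
  assumes f: "f \<in> l_hom T T" and g: "g \<in> l_hom T T"
    and eq: "\<And>x y. \<lbrakk>x \<in> carrier A; y \<in> carrier B\<rbrakk> \<Longrightarrow> f (t x y) = g (t x y)"
    and z: "z \<in> carrier T"
  shows "f z = g z"
proof -
  interpret S: l_subgroup T "carrier T" by (intro l_subgroup_carrier T.l_group_axioms)
  let ?C = "sub_copy T (carrier T) :: (('a \<times> 'b) list + 'c) lring"
  have fg: "(\<lambda>x. Inr (f x)) \<in> l_hom T ?C" "(\<lambda>x. Inr (g x)) \<in> l_hom T ?C"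
    by (intro S.Inr_comp_l_hom T.l_group_axioms f g l_hom_closed[OF f] l_hom_closed[OF g]; assumption)+
  have bil: "l_bilinear A B ?C (\<lambda>x y. Inr (f (t x y)))"
    by (intro l_bilinear_sub_copy S.l_subgroup_axioms l_bilinear_comp[OF t_bilinear f] l_hom_closed[OF f] t_closed)
  obtain h where h: "\<forall>f' \<in> l_hom T ?C. (\<forall>x \<in> carrier A. \<forall>y \<in> carrier B. f' (t x y) = Inr (f (t x y))) \<longrightarrow>
      (\<forall>z \<in> carrier T. f' z = h z)"
    using universal[OF S.l_group_sub_copy S.archimedean_sub_copy[OF archimedean_T] bil]
    by (elim bexE conjE) (rule that)
  have "Inr (f z) = h z" "Inr (g z) = h z"
    using bspec[OF h fg(1)] bspec[OF h fg(2)] eq z by simp_all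
  then show ?thesis by (metis sum.inject(2))
qed

section \<open>Calculating with tensors\<close>

lemma zero_tensor: "y \<in> carrier B \<Longrightarrow> t \<zero>\<^bsub>A\<^esub> y = \<zero>\<^bsub>T\<^esub>"
  using AT.add_hom_zero[OF t_hom1] by blast

lemma tensor_add_left: "\<lbrakk>x \<in> carrier A; x' \<in> carrier A; y \<in> carrier B\<rbrakk> \<Longrightarrow> t (x \<oplus>\<^bsub>A\<^esub> x') y = t x y \<oplus>\<^bsub>T\<^esub> t x' y"
  using add_hom_add[OF t_hom1] by blast

lemma tensor_minus_left: "\<lbrakk>x \<in> carrier A; x' \<in> carrier A; y \<in> carrier B\<rbrakk> \<Longrightarrow> t (x \<ominus>\<^bsub>A\<^esub> x') y = t x y \<ominus>\<^bsub>T\<^esub> t x' y"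
  using AT.add_hom_minus[OF t_hom1] by blast

lemma tensor_minus_right: "\<lbrakk>x \<in> carrier A; y \<in> carrier B; y' \<in> carrier B\<rbrakk> \<Longrightarrow> t x (y \<ominus>\<^bsub>B\<^esub> y') = t x y \<ominus>\<^bsub>T\<^esub> t x y'"
  using BT.add_hom_minus[OF t_hom2] by blast

lemma tensor_nonneg:
  "\<lbrakk>x \<in> carrier A; y \<in> carrier B; \<zero>\<^bsub>A\<^esub> \<preceq>\<^bsub>A\<^esub> x; \<zero>\<^bsub>B\<^esub> \<preceq>\<^bsub>B\<^esub> y\<rbrakk> \<Longrightarrow> \<zero>\<^bsub>T\<^esub> \<preceq>\<^bsub>T\<^esub> t x y"
  using BT.l_hom_nonneg[OF t_l_hom2] by blast

text \<open>First \<open>x\<close> is raised while the nonnegative \<open>y\<close> is fixed, then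
  \<open>y\<close> is raised while the nonnegative \<open>x'\<close> is fixed. The sign of
  \<open>x\<close> is left open so that differences of scalars can be inserted there.\<close>

lemma tensor_mono:
  assumes "x \<in> carrier A" "x' \<in> carrier A" "y \<in> carrier B" "y' \<in> carrier B"
    and "x \<preceq>\<^bsub>A\<^esub> x'" "y \<preceq>\<^bsub>B\<^esub> y'" "\<zero>\<^bsub>A\<^esub> \<preceq>\<^bsub>A\<^esub> x'" "\<zero>\<^bsub>B\<^esub> \<preceq>\<^bsub>B\<^esub> y"
  shows "t x y \<preceq>\<^bsub>T\<^esub> t x' y'"
  by (rule T.le_trans[OF AT.l_hom_mono[OF t_l_hom1] BT.l_hom_mono[OF t_l_hom2]]) (use assms in auto)

text \<open>The universal property factors the identity of \<open>T\<close> through any \<open>\<ell>\<close>-subgroup that contains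
  the positive tensors.\<close>

lemma generation [consumes 1, case_names tensor add uminus pos]:
  assumes z: "z \<in> carrier T"
    and tens: "\<And>x y. \<lbrakk>x \<in> carrier A; y \<in> carrier B; \<zero>\<^bsub>A\<^esub> \<preceq>\<^bsub>A\<^esub> x; \<zero>\<^bsub>B\<^esub> \<preceq>\<^bsub>B\<^esub> y\<rbrakk> \<Longrightarrow> P (t x y)"
    and add: "\<And>x y. \<lbrakk>x \<in> carrier T; y \<in> carrier T; P x; P y\<rbrakk> \<Longrightarrow> P (x \<oplus>\<^bsub>T\<^esub> y)"
    and uminus: "\<And>x. \<lbrakk>x \<in> carrier T; P x\<rbrakk> \<Longrightarrow> P (\<ominus>\<^bsub>T\<^esub> x)"
    and pos: "\<And>x. \<lbrakk>x \<in> carrier T; P x\<rbrakk> \<Longrightarrow> P (pos\<^bsub>T\<^esub> x)"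
  shows "P z"
proof -
  define S where "S = {x \<in> carrier T. P x}"
  have "P \<zero>\<^bsub>T\<^esub>" using tens[of "\<zero>\<^bsub>A\<^esub>" "\<zero>\<^bsub>B\<^esub>"] by (simp add: zero_tensor)
  then have S: "l_subgroup T S"
    by unfold_locales (auto simp: S_def add uminus pos)
  have minus: "P (x \<ominus>\<^bsub>T\<^esub> y)" if "x \<in> carrier T" "y \<in> carrier T" "P x" "P y" for x y
    using that by (simp add: T.minus_eq add uminus)
  have all: "t x y \<in> S" if "x \<in> carrier A" "y \<in> carrier B" for x y
  proof -
    \<comment> \<open>Signs are removed one factor at a time: here \<open>y\<close> is split into
      its parts, afterwards \<open>x\<close>.\<close>
    have *: "P (t x y)" if "x \<in> carrier A" "y \<in> carrier B" "\<zero>\<^bsub>A\<^esub> \<preceq>\<^bsub>A\<^esub> x" for x y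
    proof -
      have "P (t x (pos\<^bsub>B\<^esub> y) \<ominus>\<^bsub>T\<^esub> t x (pos\<^bsub>B\<^esub> (\<ominus>\<^bsub>B\<^esub> y)))"
        using that by (intro minus tens) auto
      then show ?thesis
        using that by (simp add: tensor_minus_right[symmetric] B.pos_minus_pos_uminus)
    qed
    have "P (t (pos\<^bsub>A\<^esub> x) y \<ominus>\<^bsub>T\<^esub> t (pos\<^bsub>A\<^esub> (\<ominus>\<^bsub>A\<^esub> x)) y)"
      using that by (intro minus *) auto
    then show ?thesis
      using that by (simp add: tensor_minus_left[symmetric] A.pos_minus_pos_uminus S_def)
  qed
  obtain f where f: "f \<in> l_hom T T" "\<And>x y. \<lbrakk>x \<in> carrier A; y \<in> carrier B\<rbrakk> \<Longrightarrow> f (t x y) = t x y"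
      "\<And>x. x \<in> carrier T \<Longrightarrow> f x \<in> S"
    using extension[OF S t_bilinear all] by blast
  have "f z = z"
    by (rule l_hom_eqI[OF f(1) _ f(2) z]) (auto intro!: TT.l_homI add_homI)
  then show ?thesis using f(3)[OF z] by (simp add: S_def)
qed

end

subsection \<open>The action of the ring\<close>

context unital_lu_ring
begin

section \<open>Multiplication in R by nonnegative elements\<close>

lemma one_nonneg [simp]: "\<zero> \<preceq> \<one>"
  using strong_unit_one by (simp add: strong_unit_def)

lemma ex_nat_bound: "x \<in> carrier R \<Longrightarrow> \<exists>n::nat. x \<preceq> [n] \<cdot> \<one>"
  using strong_unit_one by (simp add: strong_unit_def)

lemma mult_mono_right:
  assumes "x \<preceq> y" "\<zero> \<preceq> z" "x \<in> carrier R" "y \<in> carrier R" "z \<in> carrier R"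
  shows "x \<otimes> z \<preceq> y \<otimes> z"
proof -
  have "\<zero> \<preceq> (y \<ominus> x) \<otimes> z" using assms by (intro mult_pos) (auto simp: diff_nonneg_iff)
  moreover have "(y \<ominus> x) \<otimes> z = y \<otimes> z \<ominus> x \<otimes> z" using assms by (simp add: minus_eq l_distr l_minus)
  ultimately show ?thesis using assms by (simp add: diff_nonneg_iff)
qed

text \<open>Since \<open>r\<close> is bounded by a multiple of \<open>1\<close>, the product \<open>r x\<close> is bounded by a multiple of
  \<open>x\<close>, so multiplication by \<open>r\<close> preserves disjointness.\<close>

lemma mult_l_hom:
  assumes r: "r \<in> carrier R" "\<zero> \<preceq> r"
  shows "(\<lambda>x. r \<otimes> x) \<in> l_hom R R"
proof -
  interpret l_group_pair R R ..
  obtain n :: nat where n: "r \<preceq> [n] \<cdot> \<one>" using ex_nat_bound r by blast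
  have le: "r \<otimes> x \<preceq> [n] \<cdot> x" if "x \<in> carrier R" "\<zero> \<preceq> x" for x
    using mult_mono_right[OF n, of x] that r add_pow_ldistr[of \<one> x n] by simp
  show ?thesis
  proof (rule l_homI_disj)
    fix x y assume d: "disj R x y"
    then have "x \<in> carrier R" "y \<in> carrier R" "\<zero> \<preceq> x" "\<zero> \<preceq> y"
      using disj_nonneg disj_nonneg2 by (auto simp: disj_def)
    then show "disj R (r \<otimes> x) (r \<otimes> y)"
      using r by (intro disj_mono2[OF disj_nat_mult_both[OF d, of n n]] le mult_pos) auto
  qed (use r in \<open>auto intro!: add_homI simp: r_distr\<close>)
qed

end

locale ring_tensor_product = R: unital_lu_ring R + G: l_group G + archimedean_tensor_product R G T t
  for R :: "('r, 'm) lring_scheme" and G :: "('g, 'n) lring_scheme" and T :: "('t, 'k) lring_scheme"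
    and t :: "'r \<Rightarrow> 'g \<Rightarrow> 't" +
  fixes u :: 'g
  assumes unit: "strong_unit G u"

sublocale ring_tensor_product \<subseteq> RR: l_group_pair R R ..

context ring_tensor_product
begin

text \<open>Meant for nonnegative \<open>r\<close>: there the universal property supplies such a
  map, and \<open>l_hom_eqI\<close> makes it unique on the carrier. Other scalars are treated by
  \<open>scale\<close>.\<close>

definition act :: "'r \<Rightarrow> 't \<Rightarrow> 't" where
  "act r = (SOME f. f \<in> l_hom T T \<and>
     (\<forall>s \<in> carrier R. \<forall>g \<in> carrier G. f (t s g) = t (r \<otimes>\<^bsub>R\<^esub> s) g))"

definition e :: 't where "e = t \<one>\<^bsub>R\<^esub> u"

lemma u_closed [simp]: "u \<in> carrier G" and u_nonneg [simp]: "\<zero>\<^bsub>G\<^esub> \<preceq>\<^bsub>G\<^esub> u"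
  using unit by (auto simp: strong_unit_def)

lemma e_closed [simp]: "e \<in> carrier T"
  by (simp add: e_def)

lemma e_nonneg [simp]: "\<zero>\<^bsub>T\<^esub> \<preceq>\<^bsub>T\<^esub> e"
  by (simp add: e_def tensor_nonneg)

text \<open>In the variable \<open>s\<close> the map is multiplication by \<open>r\<close> followed
  by tensoring with \<open>g\<close>; the first of these is an l-homomorphism by
  \<open>mult_l_hom\<close>.\<close>

lemma tensor_mult_bilinear:
  assumes "r \<in> carrier R" "\<zero>\<^bsub>R\<^esub> \<preceq>\<^bsub>R\<^esub> r"
  shows "l_bilinear R G T (\<lambda>s g. t (r \<otimes>\<^bsub>R\<^esub> s) g)"
  unfolding l_bilinear_def
proof (intro conjI ballI impI)
  fix s assume s: "s \<in> carrier R"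
  show "(\<lambda>g. t (r \<otimes>\<^bsub>R\<^esub> s) g) \<in> add_hom G T"
    using t_hom2[of "r \<otimes>\<^bsub>R\<^esub> s"] s assms by simp
  assume "\<zero>\<^bsub>R\<^esub> \<preceq>\<^bsub>R\<^esub> s"
  then show "(\<lambda>g. t (r \<otimes>\<^bsub>R\<^esub> s) g) \<in> l_hom G T"
    using t_l_hom2[of "r \<otimes>\<^bsub>R\<^esub> s"] s assms by (simp add: R.mult_pos)
next
  note m = R.mult_l_hom[OF assms]
  fix g assume g: "g \<in> carrier G"
  show "(\<lambda>s. t (r \<otimes>\<^bsub>R\<^esub> s) g) \<in> add_hom R T"
    by (rule add_hom_comp[OF l_hom_imp_add_hom[OF m] t_hom1[OF g]])
  assume "\<zero>\<^bsub>G\<^esub> \<preceq>\<^bsub>G\<^esub> g"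
  then show "(\<lambda>s. t (r \<otimes>\<^bsub>R\<^esub> s) g) \<in> l_hom R T"
    by (rule l_hom_comp[OF m t_l_hom1[OF g]])
qed

lemma
  assumes "r \<in> carrier R" "\<zero>\<^bsub>R\<^esub> \<preceq>\<^bsub>R\<^esub> r"
  shows act_l_hom: "act r \<in> l_hom T T"
    and act_tensor: "\<lbrakk>s \<in> carrier R; g \<in> carrier G\<rbrakk> \<Longrightarrow> act r (t s g) = t (r \<otimes>\<^bsub>R\<^esub> s) g"
proof -
  obtain f where "f \<in> l_hom T T" "\<And>s g. \<lbrakk>s \<in> carrier R; g \<in> carrier G\<rbrakk> \<Longrightarrow> f (t s g) = t (r \<otimes>\<^bsub>R\<^esub> s) g"
    using extension[OF l_subgroup_carrier[OF T.l_group_axioms] tensor_mult_bilinear[OF assms]] assms(1)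
    by (metis R.m_closed t_closed)
  then have "\<exists>f. f \<in> l_hom T T \<and> (\<forall>s \<in> carrier R. \<forall>g \<in> carrier G. f (t s g) = t (r \<otimes>\<^bsub>R\<^esub> s) g)"
    by blast
  from someI_ex[OF this, folded act_def]
  show "act r \<in> l_hom T T" "\<lbrakk>s \<in> carrier R; g \<in> carrier G\<rbrakk> \<Longrightarrow> act r (t s g) = t (r \<otimes>\<^bsub>R\<^esub> s) g"
    by auto
qed

lemmas act_hom = l_hom_imp_add_hom[OF act_l_hom]

lemma act_closed [simp]:
  "\<lbrakk>r \<in> carrier R; \<zero>\<^bsub>R\<^esub> \<preceq>\<^bsub>R\<^esub> r; x \<in> carrier T\<rbrakk> \<Longrightarrow> act r x \<in> carrier T"
  by (rule l_hom_closed[OF act_l_hom])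

text \<open>Products of scalars are easy, unlike sums: a composite of l-homomorphisms is again one,
  so comparison on tensors decides.\<close>

lemma act_mult:
  assumes "r \<in> carrier R" "\<zero>\<^bsub>R\<^esub> \<preceq>\<^bsub>R\<^esub> r" "s \<in> carrier R" "\<zero>\<^bsub>R\<^esub> \<preceq>\<^bsub>R\<^esub> s" "x \<in> carrier T"
  shows "act (r \<otimes>\<^bsub>R\<^esub> s) x = act r (act s x)"
  by (rule l_hom_eqI[OF act_l_hom l_hom_comp[OF act_l_hom act_l_hom]])
    (use assms in \<open>auto simp: act_tensor R.mult_pos R.m_assoc\<close>)

lemma act_one: "x \<in> carrier T \<Longrightarrow> act \<one>\<^bsub>R\<^esub> x = x"
  by (rule l_hom_eqI[OF act_l_hom]) (auto simp: act_tensor intro!: TT.l_homI add_homI)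

text \<open>A case of additivity that is available early, because \<open>nat_mult_l_hom\<close>
  makes the right side an l-homomorphism. The proof of \<open>act_disj\<close> relies on it.\<close>

lemma act_nat_mult:
  assumes "r \<in> carrier R" "\<zero>\<^bsub>R\<^esub> \<preceq>\<^bsub>R\<^esub> r" "x \<in> carrier T"
  shows "act ([(n::nat)] \<cdot>\<^bsub>R\<^esub> r) x = [n] \<cdot>\<^bsub>T\<^esub> (act r x)"
proof (rule l_hom_eqI[OF act_l_hom l_hom_comp[OF act_l_hom T.nat_mult_l_hom]])
  fix s g assume sg: "s \<in> carrier R" "g \<in> carrier G"
  then have "t ([n] \<cdot>\<^bsub>R\<^esub> r \<otimes>\<^bsub>R\<^esub> s) g = t ([n] \<cdot>\<^bsub>R\<^esub> (r \<otimes>\<^bsub>R\<^esub> s)) g"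
    using assms by (simp add: R.add_pow_ldistr)
  also have "\<dots> = [n] \<cdot>\<^bsub>T\<^esub> t (r \<otimes>\<^bsub>R\<^esub> s) g"
    using AT.add_hom_nat_mult[OF t_hom1[OF sg(2)], of "r \<otimes>\<^bsub>R\<^esub> s" n] assms sg by simp
  finally show "act ([n] \<cdot>\<^bsub>R\<^esub> r) (t s g) = [n] \<cdot>\<^bsub>T\<^esub> act r (t s g)"
    using assms sg by (simp add: act_tensor R.nat_mult_nonneg)
qed (use assms in \<open>auto simp: R.nat_mult_nonneg\<close>)

lemma act_nat:
  "x \<in> carrier T \<Longrightarrow> act ([(n::nat)] \<cdot>\<^bsub>R\<^esub> \<one>\<^bsub>R\<^esub>) x = [n] \<cdot>\<^bsub>T\<^esub> x"
  by (simp add: act_nat_mult act_one)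

text \<open>The point is that \<open>M\<close> is uniform in \<open>q\<close>: it is the product of
  a bound for \<open>s\<close> by multiples of 1 and a bound for \<open>g\<close> by multiples of
  \<open>u\<close>. This makes the constant in \<open>act_approx\<close> independent of the
  scalars.\<close>

lemma tensor_bound:
  assumes s: "s \<in> carrier R" "\<zero>\<^bsub>R\<^esub> \<preceq>\<^bsub>R\<^esub> s" and g: "g \<in> carrier G" "\<zero>\<^bsub>G\<^esub> \<preceq>\<^bsub>G\<^esub> g"
  shows "\<exists>M::nat. \<forall>q \<in> carrier R. \<zero>\<^bsub>R\<^esub> \<preceq>\<^bsub>R\<^esub> q \<longrightarrow> t (q \<otimes>\<^bsub>R\<^esub> s) g \<preceq>\<^bsub>T\<^esub> [M] \<cdot>\<^bsub>T\<^esub> t q u"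
proof -
  obtain n :: nat where n: "s \<preceq>\<^bsub>R\<^esub> [n] \<cdot>\<^bsub>R\<^esub> \<one>\<^bsub>R\<^esub>" using R.ex_nat_bound s by blast
  obtain m :: nat where m: "g \<preceq>\<^bsub>G\<^esub> [m] \<cdot>\<^bsub>G\<^esub> u" using unit g by (auto simp: strong_unit_def)
  show ?thesis
  proof (intro exI ballI impI)
    fix q assume q: "q \<in> carrier R" "\<zero>\<^bsub>R\<^esub> \<preceq>\<^bsub>R\<^esub> q"
    have "q \<otimes>\<^bsub>R\<^esub> s \<preceq>\<^bsub>R\<^esub> q \<otimes>\<^bsub>R\<^esub> [n] \<cdot>\<^bsub>R\<^esub> \<one>\<^bsub>R\<^esub>"
      using RR.l_hom_mono[OF R.mult_l_hom[OF q] s(1) _ n] by simp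
    then have "q \<otimes>\<^bsub>R\<^esub> s \<preceq>\<^bsub>R\<^esub> [n] \<cdot>\<^bsub>R\<^esub> q"
      using q by (simp add: R.add_pow_rdistr)
    then have "t (q \<otimes>\<^bsub>R\<^esub> s) g \<preceq>\<^bsub>T\<^esub> t ([n] \<cdot>\<^bsub>R\<^esub> q) ([m] \<cdot>\<^bsub>G\<^esub> u)"
      using q s g m by (intro tensor_mono) (auto simp: R.nat_mult_nonneg)
    also have "t ([n] \<cdot>\<^bsub>R\<^esub> q) ([m] \<cdot>\<^bsub>G\<^esub> u) = [n] \<cdot>\<^bsub>T\<^esub> t q ([m] \<cdot>\<^bsub>G\<^esub> u)"
      using AT.add_hom_nat_mult[OF t_hom1[of "[m] \<cdot>\<^bsub>G\<^esub> u"], of q n] q by simp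
    also have "t q ([m] \<cdot>\<^bsub>G\<^esub> u) = [m] \<cdot>\<^bsub>T\<^esub> t q u"
      using BT.add_hom_nat_mult[OF t_hom2[of q], of u m] q by simp
    also have "[n] \<cdot>\<^bsub>T\<^esub> ([m] \<cdot>\<^bsub>T\<^esub> t q u) = [(m * n)] \<cdot>\<^bsub>T\<^esub> t q u"
      using q by (simp add: T.add.nat_pow_pow)
    finally show "t (q \<otimes>\<^bsub>R\<^esub> s) g \<preceq>\<^bsub>T\<^esub> [(m * n)] \<cdot>\<^bsub>T\<^esub> t q u" .
  qed
qed

lemma e_strong_unit: "strong_unit T e"
proof -
  \<comment> \<open>The negative is bounded too, since the induction has to pass through
    negatives.\<close>
  have "\<exists>(n::nat) (m::nat). x \<preceq>\<^bsub>T\<^esub> [n] \<cdot>\<^bsub>T\<^esub> e \<and> \<ominus>\<^bsub>T\<^esub> x \<preceq>\<^bsub>T\<^esub> [m] \<cdot>\<^bsub>T\<^esub> e" if "x \<in> carrier T" for x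
    using that
  proof (induction rule: generation)
    case (tensor s g)
    obtain M :: nat where
      M: "\<forall>q \<in> carrier R. \<zero>\<^bsub>R\<^esub> \<preceq>\<^bsub>R\<^esub> q \<longrightarrow> t (q \<otimes>\<^bsub>R\<^esub> s) g \<preceq>\<^bsub>T\<^esub> [M] \<cdot>\<^bsub>T\<^esub> t q u"
      using tensor_bound[OF tensor(1,3,2,4)] by blast
    have "t s g \<preceq>\<^bsub>T\<^esub> [M] \<cdot>\<^bsub>T\<^esub> e"
      using bspec[OF M, of "\<one>\<^bsub>R\<^esub>"] tensor by (simp add: e_def)
    moreover have "\<ominus>\<^bsub>T\<^esub> t s g \<preceq>\<^bsub>T\<^esub> [(0::nat)] \<cdot>\<^bsub>T\<^esub> e"
      using T.neg_nonpos tensor by (simp add: tensor_nonneg)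
    ultimately show ?case by (intro exI conjI)
  next
    case (add x y)
    then obtain n m n' m' :: nat where
      "x \<preceq>\<^bsub>T\<^esub> [n] \<cdot>\<^bsub>T\<^esub> e" "\<ominus>\<^bsub>T\<^esub> x \<preceq>\<^bsub>T\<^esub> [m] \<cdot>\<^bsub>T\<^esub> e" "y \<preceq>\<^bsub>T\<^esub> [n'] \<cdot>\<^bsub>T\<^esub> e" "\<ominus>\<^bsub>T\<^esub> y \<preceq>\<^bsub>T\<^esub> [m'] \<cdot>\<^bsub>T\<^esub> e"
      by blast
    then have "x \<oplus>\<^bsub>T\<^esub> y \<preceq>\<^bsub>T\<^esub> [(n + n')] \<cdot>\<^bsub>T\<^esub> e" "\<ominus>\<^bsub>T\<^esub> (x \<oplus>\<^bsub>T\<^esub> y) \<preceq>\<^bsub>T\<^esub> [(m + m')] \<cdot>\<^bsub>T\<^esub> e"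
      using add by (simp_all add: T.add.nat_pow_mult[symmetric] T.minus_add T.add_mono_both)
    then show ?case by (intro exI conjI)
  next
    case (uminus x)
    then show ?case by auto
  next
    case (pos x)
    then obtain n where "x \<preceq>\<^bsub>T\<^esub> [(n::nat)] \<cdot>\<^bsub>T\<^esub> e" by blast
    then have "pos\<^bsub>T\<^esub> x \<preceq>\<^bsub>T\<^esub> [n] \<cdot>\<^bsub>T\<^esub> e"
      using pos by (simp add: T.pos_least T.nat_mult_nonneg)
    moreover have "\<ominus>\<^bsub>T\<^esub> pos\<^bsub>T\<^esub> x \<preceq>\<^bsub>T\<^esub> [(0::nat)] \<cdot>\<^bsub>T\<^esub> e"
      using T.neg_nonpos pos by simp
    ultimately show ?case by (intro exI conjI)
  qed
  then show ?thesis by (auto simp: strong_unit_def)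
qed

section \<open>Local comparison of the actions of two scalars\<close>

text \<open>Where \<open>h\<close> lives, \<open>a\<close> and \<open>a'\<close> differ by at most \<open>1\<close>, so there \<open>act a x\<close> and \<open>act a' x\<close>
  differ by at most a multiple of \<open>e\<close> which depends on \<open>x\<close> only. The bound is
  inherited by sums, negatives and positive parts.\<close>

definition close :: "'r \<Rightarrow> 'r \<Rightarrow> 'r \<Rightarrow> bool" where
  "close a a' h \<longleftrightarrow> a \<in> carrier R \<and> a' \<in> carrier R \<and> \<zero>\<^bsub>R\<^esub> \<preceq>\<^bsub>R\<^esub> a \<and> \<zero>\<^bsub>R\<^esub> \<preceq>\<^bsub>R\<^esub> a' \<and>
    disj R (pos\<^bsub>R\<^esub> (a \<ominus>\<^bsub>R\<^esub> a' \<ominus>\<^bsub>R\<^esub> \<one>\<^bsub>R\<^esub>)) h \<and> disj R (pos\<^bsub>R\<^esub> (a' \<ominus>\<^bsub>R\<^esub> a \<ominus>\<^bsub>R\<^esub> \<one>\<^bsub>R\<^esub>)) h"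

lemma close_sym: "close a a' h \<Longrightarrow> close a' a h"
  by (simp add: close_def)

lemma act_approx:
  assumes "x \<in> carrier T"
  shows "\<exists>c::nat. \<forall>a a' h. close a a' h \<longrightarrow>
    disj T (pos\<^bsub>T\<^esub> (act a x \<ominus>\<^bsub>T\<^esub> act a' x \<ominus>\<^bsub>T\<^esub> [c] \<cdot>\<^bsub>T\<^esub> e)) (t h u)"
  using assms
proof (induction rule: generation)
  case (tensor s g)
  obtain M :: nat where M: "\<forall>q \<in> carrier R. \<zero>\<^bsub>R\<^esub> \<preceq>\<^bsub>R\<^esub> q \<longrightarrow> t (q \<otimes>\<^bsub>R\<^esub> s) g \<preceq>\<^bsub>T\<^esub> [M] \<cdot>\<^bsub>T\<^esub> t q u"
    using tensor_bound[OF tensor(1,3,2,4)] by blast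
  show ?case
  proof (intro exI allI impI)
    fix a a' h
    assume "close a a' h"
    then have c: "a \<in> carrier R" "a' \<in> carrier R" "\<zero>\<^bsub>R\<^esub> \<preceq>\<^bsub>R\<^esub> a" "\<zero>\<^bsub>R\<^esub> \<preceq>\<^bsub>R\<^esub> a'"
      and d: "disj R (pos\<^bsub>R\<^esub> (a \<ominus>\<^bsub>R\<^esub> a' \<ominus>\<^bsub>R\<^esub> \<one>\<^bsub>R\<^esub>)) h"
      by (simp_all add: close_def)
    \<comment> \<open>The excess of \<open>a \<ominus> a'\<close> over 1, which vanishes where
      \<open>h\<close> lives.\<close>
    define q where "q = pos\<^bsub>R\<^esub> (a \<ominus>\<^bsub>R\<^esub> a' \<ominus>\<^bsub>R\<^esub> \<one>\<^bsub>R\<^esub>)"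
    have q: "q \<in> carrier R" "\<zero>\<^bsub>R\<^esub> \<preceq>\<^bsub>R\<^esub> q" using c by (simp_all add: q_def)
    have "disj T (t q u) (t h u)"
      by (rule AT.l_hom_disj[OF t_l_hom1 d, folded q_def]) auto
    then have dM: "disj T ([M] \<cdot>\<^bsub>T\<^esub> t q u) (t h u)"
      by (rule T.disj_nat_mult)
    have "a \<ominus>\<^bsub>R\<^esub> a' \<preceq>\<^bsub>R\<^esub> q \<oplus>\<^bsub>R\<^esub> \<one>\<^bsub>R\<^esub>"
      using c R.le_pos[of "a \<ominus>\<^bsub>R\<^esub> a' \<ominus>\<^bsub>R\<^esub> \<one>\<^bsub>R\<^esub>"] R.le_minus_iff[of "a \<ominus>\<^bsub>R\<^esub> a'" q "\<one>\<^bsub>R\<^esub>"] q by (simp add: q_def)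
    then have "t ((a \<ominus>\<^bsub>R\<^esub> a') \<otimes>\<^bsub>R\<^esub> s) g \<preceq>\<^bsub>T\<^esub> t ((q \<oplus>\<^bsub>R\<^esub> \<one>\<^bsub>R\<^esub>) \<otimes>\<^bsub>R\<^esub> s) g"
      using c q tensor by (intro tensor_mono R.mult_mono_right) (auto simp: R.mult_pos R.add_nonneg)
    moreover have "t ((q \<oplus>\<^bsub>R\<^esub> \<one>\<^bsub>R\<^esub>) \<otimes>\<^bsub>R\<^esub> s) g \<preceq>\<^bsub>T\<^esub> [M] \<cdot>\<^bsub>T\<^esub> t (q \<oplus>\<^bsub>R\<^esub> \<one>\<^bsub>R\<^esub>) u"
      using q by (intro M[rule_format]) (auto simp: R.add_nonneg)
    ultimately have "t ((a \<ominus>\<^bsub>R\<^esub> a') \<otimes>\<^bsub>R\<^esub> s) g \<preceq>\<^bsub>T\<^esub> [M] \<cdot>\<^bsub>T\<^esub> t (q \<oplus>\<^bsub>R\<^esub> \<one>\<^bsub>R\<^esub>) u"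
      by (rule T.le_trans) (use c q tensor in auto)
    also have "t ((a \<ominus>\<^bsub>R\<^esub> a') \<otimes>\<^bsub>R\<^esub> s) g = act a (t s g) \<ominus>\<^bsub>T\<^esub> act a' (t s g)"
      using c tensor by (simp add: act_tensor tensor_minus_left[symmetric] R.minus_eq R.l_distr R.l_minus)
    \<comment> \<open>The summand with \<open>q\<close> is disjoint from \<open>t h u\<close>; the
      other is the permitted error, so \<open>M\<close> serves as the constant.\<close>
    also have "[M] \<cdot>\<^bsub>T\<^esub> t (q \<oplus>\<^bsub>R\<^esub> \<one>\<^bsub>R\<^esub>) u = [M] \<cdot>\<^bsub>T\<^esub> t q u \<oplus>\<^bsub>T\<^esub> [M] \<cdot>\<^bsub>T\<^esub> e"
      using q by (simp add: tensor_add_left T.add.nat_pow_distrib e_def)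
    finally show "disj T (pos\<^bsub>T\<^esub> (act a (t s g) \<ominus>\<^bsub>T\<^esub> act a' (t s g) \<ominus>\<^bsub>T\<^esub> [M] \<cdot>\<^bsub>T\<^esub> e)) (t h u)"
      using c q tensor by (intro T.disj_pos_le[OF dM]) (auto simp: T.le_minus_iff)
  qed
next
  case (add x y)
  then obtain c d :: nat where
    c: "\<forall>a a' h. close a a' h \<longrightarrow>
      disj T (pos\<^bsub>T\<^esub> (act a x \<ominus>\<^bsub>T\<^esub> act a' x \<ominus>\<^bsub>T\<^esub> [c] \<cdot>\<^bsub>T\<^esub> e)) (t h u)" and
    d: "\<forall>a a' h. close a a' h \<longrightarrow>
      disj T (pos\<^bsub>T\<^esub> (act a y \<ominus>\<^bsub>T\<^esub> act a' y \<ominus>\<^bsub>T\<^esub> [d] \<cdot>\<^bsub>T\<^esub> e)) (t h u)"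
    by blast
  show ?case
  proof (intro exI allI impI)
    fix a a' h
    assume cl: "close a a' h"
    then have a: "a \<in> carrier R" "a' \<in> carrier R" "\<zero>\<^bsub>R\<^esub> \<preceq>\<^bsub>R\<^esub> a" "\<zero>\<^bsub>R\<^esub> \<preceq>\<^bsub>R\<^esub> a'"
      by (simp_all add: close_def)
    let ?d = "\<lambda>x c. act a x \<ominus>\<^bsub>T\<^esub> act a' x \<ominus>\<^bsub>T\<^esub> [(c::nat)] \<cdot>\<^bsub>T\<^esub> e"
    have "?d (x \<oplus>\<^bsub>T\<^esub> y) (c + d) = ?d x c \<oplus>\<^bsub>T\<^esub> ?d y d"
      using add(1,2) a
      by (simp add: add_hom_add[OF act_hom] T.minus_eq T.minus_add T.add.nat_pow_mult[symmetric] T.a_ac)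
    moreover have "pos\<^bsub>T\<^esub> (?d x c \<oplus>\<^bsub>T\<^esub> ?d y d) \<preceq>\<^bsub>T\<^esub> pos\<^bsub>T\<^esub> (?d x c) \<oplus>\<^bsub>T\<^esub> pos\<^bsub>T\<^esub> (?d y d)"
      using add(1,2) a by (intro T.pos_add_le) auto
    ultimately show "disj T (pos\<^bsub>T\<^esub> (?d (x \<oplus>\<^bsub>T\<^esub> y) (c + d))) (t h u)"
      using add(1,2) a by (intro T.disj_mono[OF T.disj_add[OF c[rule_format, OF cl] d[rule_format, OF cl]]]) auto
  qed
next
  case (uminus x)
  then obtain c :: nat where
    c: "\<forall>a a' h. close a a' h \<longrightarrow>
      disj T (pos\<^bsub>T\<^esub> (act a x \<ominus>\<^bsub>T\<^esub> act a' x \<ominus>\<^bsub>T\<^esub> [c] \<cdot>\<^bsub>T\<^esub> e)) (t h u)"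
    by blast
  show ?case
  proof (intro exI allI impI)
    fix a a' h
    assume cl: "close a a' h"
    then have a: "a \<in> carrier R" "a' \<in> carrier R" "\<zero>\<^bsub>R\<^esub> \<preceq>\<^bsub>R\<^esub> a" "\<zero>\<^bsub>R\<^esub> \<preceq>\<^bsub>R\<^esub> a'"
      by (simp_all add: close_def)
    \<comment> \<open>Negating \<open>x\<close> interchanges the roles of \<open>a\<close> and
      \<open>a'\<close>, and \<open>close\<close> is symmetric in them.\<close>
    have "act a (\<ominus>\<^bsub>T\<^esub> x) \<ominus>\<^bsub>T\<^esub> act a' (\<ominus>\<^bsub>T\<^esub> x) = act a' x \<ominus>\<^bsub>T\<^esub> act a x"
      using uminus(1) a by (simp add: TT.add_hom_uminus[OF act_hom] T.minus_eq T.a_comm)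
    then show "disj T (pos\<^bsub>T\<^esub> (act a (\<ominus>\<^bsub>T\<^esub> x) \<ominus>\<^bsub>T\<^esub> act a' (\<ominus>\<^bsub>T\<^esub> x) \<ominus>\<^bsub>T\<^esub> [c] \<cdot>\<^bsub>T\<^esub> e)) (t h u)"
      using c[rule_format, OF close_sym[OF cl]] by simp
  qed
next
  case (pos x)
  then obtain c :: nat where
    c: "\<forall>a a' h. close a a' h \<longrightarrow>
      disj T (pos\<^bsub>T\<^esub> (act a x \<ominus>\<^bsub>T\<^esub> act a' x \<ominus>\<^bsub>T\<^esub> [c] \<cdot>\<^bsub>T\<^esub> e)) (t h u)"
    by blast
  show ?case
  proof (intro exI allI impI)
    fix a a' h
    assume cl: "close a a' h"
    then have a: "a \<in> carrier R" "a' \<in> carrier R" "\<zero>\<^bsub>R\<^esub> \<preceq>\<^bsub>R\<^esub> a" "\<zero>\<^bsub>R\<^esub> \<preceq>\<^bsub>R\<^esub> a'"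
      by (simp_all add: close_def)
    let ?y = "act a x" and ?y' = "act a' x" and ?c = "[c] \<cdot>\<^bsub>T\<^esub> e"
    have y: "?y \<in> carrier T" "?y' \<in> carrier T" using pos(1) a by simp_all
    \<comment> \<open>Taking positive parts does not enlarge differences, so the same constant
      \<open>c\<close> works.\<close>
    have "pos\<^bsub>T\<^esub> ?y \<ominus>\<^bsub>T\<^esub> pos\<^bsub>T\<^esub> ?y' \<ominus>\<^bsub>T\<^esub> ?c \<preceq>\<^bsub>T\<^esub> pos\<^bsub>T\<^esub> (?y \<ominus>\<^bsub>T\<^esub> ?y') \<ominus>\<^bsub>T\<^esub> ?c"
      using y by (intro T.minus_mono T.pos_minus_pos_le) auto
    then have "pos\<^bsub>T\<^esub> (pos\<^bsub>T\<^esub> ?y \<ominus>\<^bsub>T\<^esub> pos\<^bsub>T\<^esub> ?y' \<ominus>\<^bsub>T\<^esub> ?c) \<preceq>\<^bsub>T\<^esub> pos\<^bsub>T\<^esub> (pos\<^bsub>T\<^esub> (?y \<ominus>\<^bsub>T\<^esub> ?y') \<ominus>\<^bsub>T\<^esub> ?c)"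
      using y by (intro T.pos_mono) auto
    moreover have "\<dots> \<preceq>\<^bsub>T\<^esub> pos\<^bsub>T\<^esub> (?y \<ominus>\<^bsub>T\<^esub> ?y' \<ominus>\<^bsub>T\<^esub> ?c)"
      using y by (intro T.pos_pos_minus_le) (auto simp: T.nat_mult_nonneg)
    ultimately have "pos\<^bsub>T\<^esub> (pos\<^bsub>T\<^esub> ?y \<ominus>\<^bsub>T\<^esub> pos\<^bsub>T\<^esub> ?y' \<ominus>\<^bsub>T\<^esub> ?c) \<preceq>\<^bsub>T\<^esub> pos\<^bsub>T\<^esub> (?y \<ominus>\<^bsub>T\<^esub> ?y' \<ominus>\<^bsub>T\<^esub> ?c)"
      by (rule T.le_trans) (use y in auto)
    then show "disj T (pos\<^bsub>T\<^esub> (act a (pos\<^bsub>T\<^esub> x) \<ominus>\<^bsub>T\<^esub> act a' (pos\<^bsub>T\<^esub> x) \<ominus>\<^bsub>T\<^esub> ?c)) (t h u)"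
      using y pos(1) a by (intro T.disj_mono[OF c[rule_format, OF cl]]) (auto simp: TT.l_hom_pos[OF act_l_hom])
  qed
qed

text \<open>Every l-homomorphism preserves disjointness when applied to both elements. Here only one
  of them is moved, which is what sums of different maps \<open>act r\<close> require.\<close>

lemma act_disj:
  assumes r: "r \<in> carrier R" "\<zero>\<^bsub>R\<^esub> \<preceq>\<^bsub>R\<^esub> r" and xy: "disj T x y"
  shows "disj T (act r x) y"
proof -
  have c: "x \<in> carrier T" "y \<in> carrier T" "\<zero>\<^bsub>T\<^esub> \<preceq>\<^bsub>T\<^esub> x" "\<zero>\<^bsub>T\<^esub> \<preceq>\<^bsub>T\<^esub> y"
    using xy T.disj_nonneg T.disj_nonneg2 by (auto simp: disj_def)
  define z where "z = lmeet T (act r x) y"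
  have rx: "act r x \<in> carrier T" "\<zero>\<^bsub>T\<^esub> \<preceq>\<^bsub>T\<^esub> act r x"
    using r c by (auto intro: TT.l_hom_nonneg[OF act_l_hom])
  have z: "z \<in> carrier T" "\<zero>\<^bsub>T\<^esub> \<preceq>\<^bsub>T\<^esub> z" "z \<preceq>\<^bsub>T\<^esub> act r x" "z \<preceq>\<^bsub>T\<^esub> y"
    using rx c by (auto simp: z_def T.meet_greatest)
  obtain c0 :: nat where c0: "\<forall>a a' h. close a a' h \<longrightarrow>
      disj T (pos\<^bsub>T\<^esub> (act a x \<ominus>\<^bsub>T\<^esub> act a' x \<ominus>\<^bsub>T\<^esub> [c0] \<cdot>\<^bsub>T\<^esub> e)) (t h u)"
    using act_approx[OF c(1)] by blast
  let ?ce = "[c0] \<cdot>\<^bsub>T\<^esub> e"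
  have ce: "\<zero>\<^bsub>T\<^esub> \<preceq>\<^bsub>T\<^esub> ?ce" by (simp add: T.nat_mult_nonneg)
  have bound: "[N] \<cdot>\<^bsub>T\<^esub> z \<preceq>\<^bsub>T\<^esub> ?ce" for N :: nat
  proof -
    \<comment> \<open>Passing from \<open>r\<close> to its N-fold multiple multiplies
      \<open>act r x\<close> by \<open>N\<close>, while the error \<open>?ce\<close> depends only on
      \<open>x\<close> and stays fixed.\<close>
    define a where "a = [N] \<cdot>\<^bsub>R\<^esub> r"
    have a: "a \<in> carrier R" "\<zero>\<^bsub>R\<^esub> \<preceq>\<^bsub>R\<^esub> a" using r by (auto simp: a_def R.nat_mult_nonneg)
    \<comment> \<open>The excess over the claimed bound. It will turn out to be disjoint from
      \<open>e\<close> and therefore zero.\<close>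
    define v where "v = pos\<^bsub>T\<^esub> ([N] \<cdot>\<^bsub>T\<^esub> z \<ominus>\<^bsub>T\<^esub> ?ce)"
    have v: "v \<in> carrier T" "\<zero>\<^bsub>T\<^esub> \<preceq>\<^bsub>T\<^esub> v" using z by (simp_all add: v_def)
    have "[N] \<cdot>\<^bsub>T\<^esub> z \<preceq>\<^bsub>T\<^esub> [N] \<cdot>\<^bsub>T\<^esub> y" using z c by (intro T.nat_mult_mono) auto
    then have "[N] \<cdot>\<^bsub>T\<^esub> z \<preceq>\<^bsub>T\<^esub> [N] \<cdot>\<^bsub>T\<^esub> y \<oplus>\<^bsub>T\<^esub> ?ce"
      by (rule T.le_trans) (use z c ce in \<open>auto intro: T.le_add_left\<close>)
    then have v_le_y: "v \<preceq>\<^bsub>T\<^esub> [N] \<cdot>\<^bsub>T\<^esub> y"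
      using z c by (auto simp: v_def T.le_minus_iff T.nat_mult_nonneg intro!: T.pos_least)
    \<comment> \<open>Where \<open>h\<close> lives, \<open>act a x\<close> is at most
      \<open>[k] \<cdot> x\<close> plus the error. As \<open>v\<close> lies below
      \<open>[N] \<cdot> y\<close>, which is disjoint from \<open>[k] \<cdot> x\<close>, nothing of
      \<open>v\<close> remains there.\<close>
    have step: "disj T v (t h u)" if "close a ([k] \<cdot>\<^bsub>R\<^esub> \<one>\<^bsub>R\<^esub>) h" for h and k :: nat
    proof -
      define p where "p = act a x \<ominus>\<^bsub>T\<^esub> [k] \<cdot>\<^bsub>T\<^esub> x \<ominus>\<^bsub>T\<^esub> ?ce"
      have p: "p \<in> carrier T" using a c by (simp add: p_def)
      have dp: "disj T (pos\<^bsub>T\<^esub> p) (t h u)"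
        using c0[rule_format, OF that] c by (simp add: act_nat p_def)
      have "[N] \<cdot>\<^bsub>T\<^esub> z \<preceq>\<^bsub>T\<^esub> [N] \<cdot>\<^bsub>T\<^esub> act r x" using z rx by (intro T.nat_mult_mono) auto
      then have "[N] \<cdot>\<^bsub>T\<^esub> z \<ominus>\<^bsub>T\<^esub> ?ce \<preceq>\<^bsub>T\<^esub> act a x \<ominus>\<^bsub>T\<^esub> ?ce"
        using z rx r c by (simp add: a_def act_nat_mult T.minus_mono)
      also have "act a x \<ominus>\<^bsub>T\<^esub> ?ce = p \<oplus>\<^bsub>T\<^esub> [k] \<cdot>\<^bsub>T\<^esub> x"
      proof -
        have "p = (act a x \<ominus>\<^bsub>T\<^esub> ?ce) \<ominus>\<^bsub>T\<^esub> [k] \<cdot>\<^bsub>T\<^esub> x"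
          using a c by (simp add: p_def T.minus_eq T.a_assoc T.a_comm[of "\<ominus>\<^bsub>T\<^esub> ?ce"])
        then show ?thesis using a c by simp
      qed
      finally have "[N] \<cdot>\<^bsub>T\<^esub> z \<ominus>\<^bsub>T\<^esub> ?ce \<preceq>\<^bsub>T\<^esub> p \<oplus>\<^bsub>T\<^esub> [k] \<cdot>\<^bsub>T\<^esub> x" .
      moreover have "p \<oplus>\<^bsub>T\<^esub> [k] \<cdot>\<^bsub>T\<^esub> x \<preceq>\<^bsub>T\<^esub> pos\<^bsub>T\<^esub> p \<oplus>\<^bsub>T\<^esub> [k] \<cdot>\<^bsub>T\<^esub> x"
        using p c by (intro T.add_mono) auto
      ultimately have "[N] \<cdot>\<^bsub>T\<^esub> z \<ominus>\<^bsub>T\<^esub> ?ce \<preceq>\<^bsub>T\<^esub> pos\<^bsub>T\<^esub> p \<oplus>\<^bsub>T\<^esub> [k] \<cdot>\<^bsub>T\<^esub> x"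
        by (rule T.le_trans) (use p c z in auto)
      then have "v \<preceq>\<^bsub>T\<^esub> pos\<^bsub>T\<^esub> p \<oplus>\<^bsub>T\<^esub> [k] \<cdot>\<^bsub>T\<^esub> x"
        using p c z by (auto simp: v_def intro!: T.pos_least T.add_nonneg T.nat_mult_nonneg)
      then show ?thesis
        using T.disj_split[OF dp T.disj_nat_mult_both[OF xy, of k N]] v v_le_y by blast
    qed
    \<comment> \<open>By induction, \<open>v\<close> vanishes wherever \<open>a\<close> is below
      \<open>k\<close>. Each step adds the region where \<open>a\<close> is within 1 of
      \<open>k\<close>.\<close>
    have far: "disj T v (t (pos\<^bsub>R\<^esub> ([k] \<cdot>\<^bsub>R\<^esub> \<one>\<^bsub>R\<^esub> \<ominus>\<^bsub>R\<^esub> a)) u)" for k :: nat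
    proof (induction k)
      case 0
      have "pos\<^bsub>R\<^esub> ([(0::nat)] \<cdot>\<^bsub>R\<^esub> \<one>\<^bsub>R\<^esub> \<ominus>\<^bsub>R\<^esub> a) = \<zero>\<^bsub>R\<^esub>"
        using a R.neg_nonpos[of a] by (simp add: R.minus_eq R.pos_eq_zero)
      then show ?case using T.disj_sym[OF T.zero_disj[OF v]] by (simp add: zero_tensor)
    next
      case (Suc k)
      define b where "b = a \<ominus>\<^bsub>R\<^esub> [k] \<cdot>\<^bsub>R\<^esub> \<one>\<^bsub>R\<^esub>"
      define d where "d = pos\<^bsub>R\<^esub> (\<one>\<^bsub>R\<^esub> \<ominus>\<^bsub>R\<^esub> b)"
      define d' where "d' = pos\<^bsub>R\<^esub> (\<one>\<^bsub>R\<^esub> \<oplus>\<^bsub>R\<^esub> b)"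
      \<comment> \<open>The hat function around the place where \<open>a\<close> equals
        \<open>k\<close>: it is disjoint from the excess over 1 of \<open>b\<close> and of its
        negative, as \<open>close\<close> demands.\<close>
      define h where "h = lmeet R d d'"
      have b: "b \<in> carrier R" using a by (simp add: b_def)
      have nb: "\<ominus>\<^bsub>R\<^esub> b = [k] \<cdot>\<^bsub>R\<^esub> \<one>\<^bsub>R\<^esub> \<ominus>\<^bsub>R\<^esub> a"
        using a by (simp add: b_def R.minus_eq R.minus_add R.a_comm)
      have dd: "d \<in> carrier R" "d' \<in> carrier R" "\<zero>\<^bsub>R\<^esub> \<preceq>\<^bsub>R\<^esub> d" "\<zero>\<^bsub>R\<^esub> \<preceq>\<^bsub>R\<^esub> d'"
        using b by (simp_all add: d_def d'_def)
      have h: "h \<in> carrier R" "\<zero>\<^bsub>R\<^esub> \<preceq>\<^bsub>R\<^esub> h" "h \<preceq>\<^bsub>R\<^esub> d" "h \<preceq>\<^bsub>R\<^esub> d'"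
        using dd by (simp_all add: h_def R.meet_greatest)
      have "disj R (pos\<^bsub>R\<^esub> (b \<ominus>\<^bsub>R\<^esub> \<one>\<^bsub>R\<^esub>)) d"
        unfolding d_def using b
        by (intro R.pos_le_disj_pos) (simp_all add: R.minus_eq R.minus_add R.a_comm)
      then have 1: "disj R (pos\<^bsub>R\<^esub> (b \<ominus>\<^bsub>R\<^esub> \<one>\<^bsub>R\<^esub>)) h"
        by (rule R.disj_mono2) (use h b in auto)
      have "disj R (pos\<^bsub>R\<^esub> (\<ominus>\<^bsub>R\<^esub> b \<ominus>\<^bsub>R\<^esub> \<one>\<^bsub>R\<^esub>)) d'"
        unfolding d'_def using b
        by (intro R.pos_le_disj_pos) (simp_all add: R.minus_eq R.minus_add R.a_comm)
      then have 2: "disj R (pos\<^bsub>R\<^esub> (\<ominus>\<^bsub>R\<^esub> b \<ominus>\<^bsub>R\<^esub> \<one>\<^bsub>R\<^esub>)) h"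
        by (rule R.disj_mono2) (use h b in auto)
      have "close a ([k] \<cdot>\<^bsub>R\<^esub> \<one>\<^bsub>R\<^esub>) h"
        using 1 2 a unfolding close_def nb b_def[symmetric] by (simp add: R.nat_mult_nonneg)
      from step[OF this] have dh: "disj T (t h u) v" by (rule T.disj_sym)
      let ?n = "pos\<^bsub>R\<^esub> (\<ominus>\<^bsub>R\<^esub> b)"
      have dn: "disj T (t ?n u) v" using Suc T.disj_sym unfolding nb by blast
      \<comment> \<open>The induction hypothesis covers the two copies of \<open>?n\<close> and
        \<open>step\<close> covers \<open>h\<close>; by \<open>hat_cover\<close> the three together
        dominate \<open>d\<close>.\<close>
      have "disj T (t ?n u \<oplus>\<^bsub>T\<^esub> t ?n u \<oplus>\<^bsub>T\<^esub> t h u) v"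
        by (intro T.disj_add dn dh)
      also have "t ?n u \<oplus>\<^bsub>T\<^esub> t ?n u \<oplus>\<^bsub>T\<^esub> t h u = t (?n \<oplus>\<^bsub>R\<^esub> ?n \<oplus>\<^bsub>R\<^esub> h) u"
        using b h by (simp add: tensor_add_left)
      finally have "disj T (t d u) v"
        by (rule T.disj_mono)
          (use b h dd R.hat_cover[of b "\<one>\<^bsub>R\<^esub>"] in
            \<open>auto simp: tensor_nonneg R.add_nonneg d_def d'_def h_def intro!: tensor_mono\<close>)
      moreover have "[Suc k] \<cdot>\<^bsub>R\<^esub> \<one>\<^bsub>R\<^esub> \<ominus>\<^bsub>R\<^esub> a = \<one>\<^bsub>R\<^esub> \<ominus>\<^bsub>R\<^esub> b"
      proof -
        have "\<one>\<^bsub>R\<^esub> \<ominus>\<^bsub>R\<^esub> b = \<one>\<^bsub>R\<^esub> \<oplus>\<^bsub>R\<^esub> ([k] \<cdot>\<^bsub>R\<^esub> \<one>\<^bsub>R\<^esub> \<ominus>\<^bsub>R\<^esub> a)"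
          using b nb by (simp add: R.minus_eq)
        also have "\<dots> = [Suc k] \<cdot>\<^bsub>R\<^esub> \<one>\<^bsub>R\<^esub> \<ominus>\<^bsub>R\<^esub> a"
          using a by (simp add: R.minus_eq R.a_ac)
        finally show ?thesis by simp
      qed
      ultimately show ?case using T.disj_sym by (simp add: d_def)
    qed
    obtain K :: nat where K: "a \<preceq>\<^bsub>R\<^esub> [K] \<cdot>\<^bsub>R\<^esub> \<one>\<^bsub>R\<^esub>" using R.ex_nat_bound a by blast
    \<comment> \<open>One more than the bound \<open>K\<close> is taken so that the difference to
      \<open>a\<close> is at least 1, which makes \<open>v\<close> disjoint from
      \<open>e\<close>.\<close>
    have "\<one>\<^bsub>R\<^esub> \<oplus>\<^bsub>R\<^esub> a \<preceq>\<^bsub>R\<^esub> [Suc K] \<cdot>\<^bsub>R\<^esub> \<one>\<^bsub>R\<^esub>"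
      using R.add_mono[OF _ _ _ K, of "\<one>\<^bsub>R\<^esub>"] a by (simp add: R.a_comm)
    then have "(\<one>\<^bsub>R\<^esub> \<oplus>\<^bsub>R\<^esub> a) \<ominus>\<^bsub>R\<^esub> a \<preceq>\<^bsub>R\<^esub> [Suc K] \<cdot>\<^bsub>R\<^esub> \<one>\<^bsub>R\<^esub> \<ominus>\<^bsub>R\<^esub> a"
      using a by (intro R.minus_mono) auto
    moreover have "(\<one>\<^bsub>R\<^esub> \<oplus>\<^bsub>R\<^esub> a) \<ominus>\<^bsub>R\<^esub> a = \<one>\<^bsub>R\<^esub>" using a by simp
    ultimately have "\<one>\<^bsub>R\<^esub> \<preceq>\<^bsub>R\<^esub> [Suc K] \<cdot>\<^bsub>R\<^esub> \<one>\<^bsub>R\<^esub> \<ominus>\<^bsub>R\<^esub> a" by argo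
    moreover have "[Suc K] \<cdot>\<^bsub>R\<^esub> \<one>\<^bsub>R\<^esub> \<ominus>\<^bsub>R\<^esub> a \<preceq>\<^bsub>R\<^esub> pos\<^bsub>R\<^esub> ([Suc K] \<cdot>\<^bsub>R\<^esub> \<one>\<^bsub>R\<^esub> \<ominus>\<^bsub>R\<^esub> a)"
      using a by (intro R.le_pos) auto
    ultimately have "\<one>\<^bsub>R\<^esub> \<preceq>\<^bsub>R\<^esub> pos\<^bsub>R\<^esub> ([Suc K] \<cdot>\<^bsub>R\<^esub> \<one>\<^bsub>R\<^esub> \<ominus>\<^bsub>R\<^esub> a)"
      by (rule R.le_trans) (use a in auto)
    then have "disj T e v"
      unfolding e_def using a by (intro T.disj_mono[OF T.disj_sym[OF far[of "Suc K"]]] tensor_mono tensor_nonneg) auto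
    moreover obtain M :: nat where M: "v \<preceq>\<^bsub>T\<^esub> [M] \<cdot>\<^bsub>T\<^esub> e"
      using e_strong_unit v(1) unfolding strong_unit_def by blast
    ultimately have "disj T v v"
      using v by (blast intro: T.disj_mono[OF T.disj_nat_mult])
    then have "v = \<zero>\<^bsub>T\<^esub>" by (rule T.disj_self)
    then have "[N] \<cdot>\<^bsub>T\<^esub> z \<ominus>\<^bsub>T\<^esub> ?ce \<preceq>\<^bsub>T\<^esub> \<zero>\<^bsub>T\<^esub>"
      using T.le_pos[of "[N] \<cdot>\<^bsub>T\<^esub> z \<ominus>\<^bsub>T\<^esub> ?ce"] z by (simp add: v_def)
    then show ?thesis using z by (simp add: T.le_minus_iff)
  qed
  have "z \<preceq>\<^bsub>T\<^esub> \<zero>\<^bsub>T\<^esub>"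
    using archimedean_T z(1) bound unfolding archimedean_def by (meson T.add.nat_pow_closed e_closed)
  then have "z = \<zero>\<^bsub>T\<^esub>" using z by (intro T.le_antisym) auto
  then show ?thesis using rx c by (simp add: disj_def z_def)
qed

lemma act_add:
  assumes r: "r \<in> carrier R" "\<zero>\<^bsub>R\<^esub> \<preceq>\<^bsub>R\<^esub> r" and s: "s \<in> carrier R" "\<zero>\<^bsub>R\<^esub> \<preceq>\<^bsub>R\<^esub> s" and x: "x \<in> carrier T"
  shows "act (r \<oplus>\<^bsub>R\<^esub> s) x = act r x \<oplus>\<^bsub>T\<^esub> act s x"
proof -
  have sum: "(\<lambda>x. act r x \<oplus>\<^bsub>T\<^esub> act s x) \<in> l_hom T T"
  proof (rule TT.l_homI_disj)
    show "(\<lambda>x. act r x \<oplus>\<^bsub>T\<^esub> act s x) \<in> add_hom T T"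
      using r s by (intro add_homI) (auto simp: add_hom_add[OF act_hom] T.a_ac)
    fix x y assume xy: "disj T x y"
    \<comment> \<open>The mixed pairs, with \<open>p\<close> and \<open>q\<close> different, are why
      \<open>act_disj\<close> is applied on either side in turn.\<close>
    have *: "disj T (act p x) (act q y)"
      if "p \<in> carrier R" "\<zero>\<^bsub>R\<^esub> \<preceq>\<^bsub>R\<^esub> p" "q \<in> carrier R" "\<zero>\<^bsub>R\<^esub> \<preceq>\<^bsub>R\<^esub> q" for p q
      by (rule act_disj[OF that(1,2) T.disj_sym[OF act_disj[OF that(3,4) T.disj_sym[OF xy]]]])
    show "disj T (act r x \<oplus>\<^bsub>T\<^esub> act s x) (act r y \<oplus>\<^bsub>T\<^esub> act s y)"
      by (intro T.disj_add T.disj_sym[OF T.disj_add] T.disj_sym[OF *] r s)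
  qed
  show ?thesis
    by (rule l_hom_eqI[OF act_l_hom sum])
      (use assms in \<open>auto simp: act_tensor tensor_add_left R.l_distr R.add_nonneg\<close>)
qed

section \<open>Scalars of arbitrary sign\<close>

definition scale :: "'r \<Rightarrow> 't \<Rightarrow> 't" where
  "scale r x = act (pos\<^bsub>R\<^esub> r) x \<ominus>\<^bsub>T\<^esub> act (pos\<^bsub>R\<^esub> (\<ominus>\<^bsub>R\<^esub> r)) x"

text \<open>Any representation as a difference of nonnegative elements may be used: cross-adding two
  representations gives an equation between nonnegative scalars, where \<open>act_add\<close>
  applies. This frees the module laws from positive parts, which do not respect sums and
  products.\<close>

lemma scale_minus:
  assumes a: "a \<in> carrier R" "\<zero>\<^bsub>R\<^esub> \<preceq>\<^bsub>R\<^esub> a" and b: "b \<in> carrier R" "\<zero>\<^bsub>R\<^esub> \<preceq>\<^bsub>R\<^esub> b" and x: "x \<in> carrier T"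
  shows "scale (a \<ominus>\<^bsub>R\<^esub> b) x = act a x \<ominus>\<^bsub>T\<^esub> act b x"
proof -
  define p where "p = pos\<^bsub>R\<^esub> (a \<ominus>\<^bsub>R\<^esub> b)"
  define q where "q = pos\<^bsub>R\<^esub> (\<ominus>\<^bsub>R\<^esub> (a \<ominus>\<^bsub>R\<^esub> b))"
  have pq: "p \<in> carrier R" "\<zero>\<^bsub>R\<^esub> \<preceq>\<^bsub>R\<^esub> p" "q \<in> carrier R" "\<zero>\<^bsub>R\<^esub> \<preceq>\<^bsub>R\<^esub> q"
    using a b by (simp_all add: p_def q_def)
  have "p \<ominus>\<^bsub>R\<^esub> q = a \<ominus>\<^bsub>R\<^esub> b" using a b by (simp add: p_def q_def R.pos_minus_pos_uminus)
  then have p: "p = (a \<ominus>\<^bsub>R\<^esub> b) \<oplus>\<^bsub>R\<^esub> q" using R.minus_add_cancel[of p q] pq by simp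
  have "(a \<ominus>\<^bsub>R\<^esub> b) \<oplus>\<^bsub>R\<^esub> q \<oplus>\<^bsub>R\<^esub> b = ((a \<ominus>\<^bsub>R\<^esub> b) \<oplus>\<^bsub>R\<^esub> b) \<oplus>\<^bsub>R\<^esub> q"
    using a b pq by (simp only: R.a_assoc R.a_comm[of q b] R.minus_closed)
  then have "p \<oplus>\<^bsub>R\<^esub> b = a \<oplus>\<^bsub>R\<^esub> q" using a b p by simp
  then have "act p x \<oplus>\<^bsub>T\<^esub> act b x = act a x \<oplus>\<^bsub>T\<^esub> act q x"
    using a b pq x by (simp add: act_add[symmetric])
  then have "(act p x \<oplus>\<^bsub>T\<^esub> act b x) \<ominus>\<^bsub>T\<^esub> act b x \<ominus>\<^bsub>T\<^esub> act q x = (act a x \<oplus>\<^bsub>T\<^esub> act q x) \<ominus>\<^bsub>T\<^esub> act b x \<ominus>\<^bsub>T\<^esub> act q x"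
    by simp
  moreover have "(act a x \<oplus>\<^bsub>T\<^esub> act q x) \<ominus>\<^bsub>T\<^esub> act b x \<ominus>\<^bsub>T\<^esub> act q x = ((act a x \<ominus>\<^bsub>T\<^esub> act b x) \<oplus>\<^bsub>T\<^esub> act q x) \<ominus>\<^bsub>T\<^esub> act q x"
    using a b pq x by (simp add: T.minus_eq T.a_assoc T.a_comm[of "act q x"])
  ultimately show ?thesis
    using a b pq x by (simp add: scale_def p_def[symmetric] q_def[symmetric])
qed

lemma scale_nonneg:
  assumes "r \<in> carrier R" "\<zero>\<^bsub>R\<^esub> \<preceq>\<^bsub>R\<^esub> r" "x \<in> carrier T"
  shows "scale r x = act r x"
proof -
  have "act \<zero>\<^bsub>R\<^esub> x = [(0::nat)] \<cdot>\<^bsub>T\<^esub> x"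
    using act_nat[OF assms(3), of 0] by simp
  then show ?thesis
    using scale_minus[of r "\<zero>\<^bsub>R\<^esub>" x] assms by (simp add: R.minus_eq T.minus_eq)
qed

lemma nonneg_difference:
  assumes "r \<in> carrier R"
  obtains a b where "a \<in> carrier R" "\<zero>\<^bsub>R\<^esub> \<preceq>\<^bsub>R\<^esub> a" "b \<in> carrier R" "\<zero>\<^bsub>R\<^esub> \<preceq>\<^bsub>R\<^esub> b" "r = a \<ominus>\<^bsub>R\<^esub> b"
  by (rule that[of "pos\<^bsub>R\<^esub> r" "pos\<^bsub>R\<^esub> (\<ominus>\<^bsub>R\<^esub> r)"]) (use assms in \<open>auto simp: R.pos_minus_pos_uminus\<close>)

lemma scale_add_left:
  assumes "r \<in> carrier R" "s \<in> carrier R" "x \<in> carrier T"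
  shows "scale (r \<oplus>\<^bsub>R\<^esub> s) x = scale r x \<oplus>\<^bsub>T\<^esub> scale s x"
proof -
  obtain a b where r: "a \<in> carrier R" "\<zero>\<^bsub>R\<^esub> \<preceq>\<^bsub>R\<^esub> a" "b \<in> carrier R" "\<zero>\<^bsub>R\<^esub> \<preceq>\<^bsub>R\<^esub> b" "r = a \<ominus>\<^bsub>R\<^esub> b"
    by (rule nonneg_difference[OF assms(1)])
  obtain c d where s: "c \<in> carrier R" "\<zero>\<^bsub>R\<^esub> \<preceq>\<^bsub>R\<^esub> c" "d \<in> carrier R" "\<zero>\<^bsub>R\<^esub> \<preceq>\<^bsub>R\<^esub> d" "s = c \<ominus>\<^bsub>R\<^esub> d"
    by (rule nonneg_difference[OF assms(2)])
  have "r \<oplus>\<^bsub>R\<^esub> s = (a \<oplus>\<^bsub>R\<^esub> c) \<ominus>\<^bsub>R\<^esub> (b \<oplus>\<^bsub>R\<^esub> d)"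
    using r s by (simp add: R.minus_eq R.minus_add R.a_ac)
  then have "scale (r \<oplus>\<^bsub>R\<^esub> s) x = act (a \<oplus>\<^bsub>R\<^esub> c) x \<ominus>\<^bsub>T\<^esub> act (b \<oplus>\<^bsub>R\<^esub> d) x"
    using r s assms(3) by (simp add: scale_minus R.add_nonneg)
  then show ?thesis
    using r s assms(3) by (simp add: scale_minus act_add T.add_diff_add)
qed

lemma scale_add_right:
  assumes "r \<in> carrier R" "x \<in> carrier T" "y \<in> carrier T"
  shows "scale r (x \<oplus>\<^bsub>T\<^esub> y) = scale r x \<oplus>\<^bsub>T\<^esub> scale r y"
  using assms by (simp add: scale_def add_hom_add[OF act_hom] T.add_diff_add)

lemma scale_mult:
  assumes "r \<in> carrier R" "s \<in> carrier R" "x \<in> carrier T"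
  shows "scale (r \<otimes>\<^bsub>R\<^esub> s) x = scale r (scale s x)"
proof -
  obtain a b where r: "a \<in> carrier R" "\<zero>\<^bsub>R\<^esub> \<preceq>\<^bsub>R\<^esub> a" "b \<in> carrier R" "\<zero>\<^bsub>R\<^esub> \<preceq>\<^bsub>R\<^esub> b" "r = a \<ominus>\<^bsub>R\<^esub> b"
    by (rule nonneg_difference[OF assms(1)])
  obtain c d where s: "c \<in> carrier R" "\<zero>\<^bsub>R\<^esub> \<preceq>\<^bsub>R\<^esub> c" "d \<in> carrier R" "\<zero>\<^bsub>R\<^esub> \<preceq>\<^bsub>R\<^esub> d" "s = c \<ominus>\<^bsub>R\<^esub> d"
    by (rule nonneg_difference[OF assms(2)])
  note [simp] = R.mult_pos R.add_nonneg
  \<comment> \<open>The expanded product is regrouped as a difference of two nonnegative sums, the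
    form that \<open>scale_minus\<close> needs.\<close>
  have "r \<otimes>\<^bsub>R\<^esub> s = (a \<otimes>\<^bsub>R\<^esub> c \<oplus>\<^bsub>R\<^esub> b \<otimes>\<^bsub>R\<^esub> d) \<ominus>\<^bsub>R\<^esub> (b \<otimes>\<^bsub>R\<^esub> c \<oplus>\<^bsub>R\<^esub> a \<otimes>\<^bsub>R\<^esub> d)"
    using r s by (simp add: R.minus_eq R.minus_add R.l_distr R.r_distr R.l_minus R.r_minus R.a_ac)
  then have "scale (r \<otimes>\<^bsub>R\<^esub> s) x =
     (act a (act c x) \<oplus>\<^bsub>T\<^esub> act b (act d x)) \<ominus>\<^bsub>T\<^esub> (act b (act c x) \<oplus>\<^bsub>T\<^esub> act a (act d x))"
    using r s assms(3) by (simp add: scale_minus act_add act_mult)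
  moreover have "scale r (scale s x) =
     (act a (act c x) \<ominus>\<^bsub>T\<^esub> act a (act d x)) \<ominus>\<^bsub>T\<^esub> (act b (act c x) \<ominus>\<^bsub>T\<^esub> act b (act d x))"
    using r s assms(3) by (simp add: scale_minus TT.add_hom_minus[OF act_hom])
  ultimately show ?thesis
    using r s assms(3) by (simp add: T.minus_eq T.minus_add T.a_ac)
qed

text \<open>Identifies the module structure as the natural one, induced by left multiplication in
  the first factor.\<close>

lemma scale_tensor:
  assumes "r \<in> carrier R" "s \<in> carrier R" "g \<in> carrier G"
  shows "scale r (t s g) = t (r \<otimes>\<^bsub>R\<^esub> s) g"
proof -
  obtain a b where r: "a \<in> carrier R" "\<zero>\<^bsub>R\<^esub> \<preceq>\<^bsub>R\<^esub> a" "b \<in> carrier R" "\<zero>\<^bsub>R\<^esub> \<preceq>\<^bsub>R\<^esub> b" "r = a \<ominus>\<^bsub>R\<^esub> b"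
    by (rule nonneg_difference[OF assms(1)])
  then have "r \<otimes>\<^bsub>R\<^esub> s = a \<otimes>\<^bsub>R\<^esub> s \<ominus>\<^bsub>R\<^esub> b \<otimes>\<^bsub>R\<^esub> s"
    using assms by (simp add: R.minus_eq R.l_distr R.l_minus)
  then show ?thesis
    using r assms by (simp add: scale_minus act_tensor tensor_minus_left)
qed

lemma lu_module_scale: "lu_module R T scale"
proof
  fix r assume r: "r \<in> carrier R" "\<zero>\<^bsub>R\<^esub> \<preceq>\<^bsub>R\<^esub> r"
  show "scale r \<in> l_hom T T"
    by (intro TT.l_homI add_homI)
      (use r in \<open>auto simp: scale_nonneg add_hom_add[OF act_hom] TT.l_hom_pos[OF act_l_hom]\<close>)
  show "\<zero>\<^bsub>T\<^esub> \<preceq>\<^bsub>T\<^esub> scale r x" if "x \<in> carrier T" "\<zero>\<^bsub>T\<^esub> \<preceq>\<^bsub>T\<^esub> x" for x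
    using r that by (simp add: scale_nonneg TT.l_hom_nonneg[OF act_l_hom])
next
  show "\<exists>u. strong_unit T u" using e_strong_unit ..
  show "scale r x \<in> carrier T" if "r \<in> carrier R" "x \<in> carrier T" for r x
    using that by (simp add: scale_def)
qed (simp_all add: scale_add_left scale_add_right scale_mult scale_nonneg act_one)

end

theorem theorem3p7:
  fixes R :: "('r, 'm) lring_scheme"
    and G :: "('g, 'n) lring_scheme"
    and T :: "('t, 'k) lring_scheme"
    and tensor :: "'r \<Rightarrow> 'g \<Rightarrow> 't"
  assumes "unital_lu_ring R" and "archimedean R"
    and "lu_group G" and "archimedean G"
    and "archimedean_tensor R G T tensor"
  shows "\<exists>scale. lu_module R T scale \<and>
    (\<forall>r \<in> carrier R. \<forall>s \<in> carrier R. \<forall>g \<in> carrier G.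
       scale r (tensor s g) = tensor (r \<otimes>\<^bsub>R\<^esub> s) g)"
proof -
  interpret R: unital_lu_ring R by fact
  interpret G: lu_group G by fact
  interpret T: l_group T using assms(5) by (simp add: archimedean_tensor_def)
  obtain u where u: "strong_unit G u" using G.ex_strong_unit by blast
  interpret ring_tensor_product R G T tensor u
    by unfold_locales (fact assms(5) u)+
  show ?thesis using lu_module_scale scale_tensor by blast
qed

end
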